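(* Let $(\Omega,\mathcal{F},\mu)$ be a non-atomic Lebesgue probability space and let $(a_n)_{n\ge 0}$ be a sequence of positive real numbers which decreases to zero. Then there exist a bijective, bimeasurable, $\mu$-preserving transformation $T:\Omega\to\Omega$ and an integer-valued function $f\in L^\infty(\Omega)$ with a non-degenerate distribution such that: (i) the process $(f\circ T^k)_{k\ge 0}$ is a strongly mixing martingale difference sequence which takes only the values $-1$, $0$ and $1$; (ii) there exists an increasing sequence $(n_k)_{k\ge 0}$ of positive integers such that for every integer $k\ge 0$, $$\mu(S_{n_k}(f)=0)\ge a_{n_k}$$ and $$\sup_{x\in\mathbb{R}}|F_{n_k}(f,x)-\Phi(x)|\ge \frac{a_{n_k}}{2}.$$
   Context: For an integer $n\ge 1$ and a zero-mean random variable $f$ on $\Omega$, $S_n(f)=\sum_{k=0}^{n-1} f\circ T^k$ and $F_n(f,x)=\mu\big(S_n(f)\le x\sigma\sqrt{n}\big)$ for $x\in\mathbb{R}$, where $\sigma^2=E(f^2)$ and $E$ is expectation with respect to $\mu$. $\Phi$ is the distribution function of the standard normal law. A sequence $(X_k)_{k\ge 0}$ of real random variables is a martingale difference sequence if for every integer $k\ge 0$, $E(X_k\mid\sigma(X_j;\, 0\le j<k))=0$ a.s. For sub-$\sigma$-algebras $\mathcal{U},\mathcal{V}$ of $\mathcal{F}$, $\alpha(\mathcal{U},\mathcal{V})=\sup\{|\mu(U\cap V)-\mu(U)\mu(V)| : U\in\mathcal{U},\ V\in\mathcal{V}\}$. For a sequence $(X_k)_{k\ge 0}$ of real random variables and integers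 $s,t\ge 0$, let $\mathcal{F}_\infty^s$ be the $\sigma$-algebra generated by the $X_j$ with $j\le s$ and $\mathcal{F}_t^\infty$ the $\sigma$-algebra generated by the $X_j$ with $j\ge t$; put $\alpha(n)=\sup_{k\ge 0}\alpha(\mathcal{F}_\infty^k,\mathcal{F}_{k+n}^\infty)$ for $n\geq 1$. The sequence is strongly mixing ($\alpha$-mixing) if $\alpha(n)\to 0$ as $n\to\infty$. A distribution is non-degenerate if it is not concentrated at a single point. An increasing sequence of integers means $n_k<n_{k+1}$ for all $k$. *)

theory Defs
  imports "HOL-Probability.Probability"
begin

text \<open>Isomorphism modulo null sets: after removing a null set from each space, a bimeasurable
  measure-preserving bijection between what remains.\<close>

definition isomorphic_mod0 :: "'a measure \<Rightarrow> 'b measure \<Rightarrow> bool" where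
  "isomorphic_mod0 M N \<longleftrightarrow>
    (\<exists>A\<in>null_sets M. \<exists>B\<in>null_sets N. \<exists>\<phi>.
      let M' = restrict_space M (space M - A); N' = restrict_space N (space N - B) in
        bij_betw \<phi> (space M') (space N') \<and>
        \<phi> \<in> M' \<rightarrow>\<^sub>M N' \<and>
        the_inv_into (space M') \<phi> \<in> N' \<rightarrow>\<^sub>M M' \<and>
        distr M' N' \<phi> = N')"

text \<open>A Lebesgue probability space in the sense of Rokhlin: a complete probability space consisting of
  countably many points of positive measure and of a part isomorphic modulo null sets to an interval
  \<open>[0, s]\<close> (possibly \<open>s = 0\<close>) with Lebesgue measure on the Lebesgue measurable sets.\<close>

definition lebesgue_prob_space :: "'a measure \<Rightarrow> bool" where
  "lebesgue_prob_space M \<longleftrightarrow>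
    prob_space M \<and> complete_measure M \<and>
    (\<exists>C s. countable C \<and> C \<subseteq> space M \<and>
      (\<forall>c\<in>C. {c} \<in> sets M \<and> emeasure M {c} > 0) \<and>
      s \<ge> 0 \<and> isomorphic_mod0 (restrict_space M (space M - C)) (lebesgue_on {0..s::real}))"

definition non_atomic :: "'a measure \<Rightarrow> bool" where
  "non_atomic M \<longleftrightarrow>
    (\<forall>A\<in>sets M. emeasure M A > 0 \<longrightarrow>
      (\<exists>B\<in>sets M. B \<subseteq> A \<and> 0 < emeasure M B \<and> emeasure M B < emeasure M A))"

definition mp_automorphism :: "'a measure \<Rightarrow> ('a \<Rightarrow> 'a) \<Rightarrow> bool" where
  "mp_automorphism M T \<longleftrightarrow>
    bij_betw T (space M) (space M) \<and>
    T \<in> M \<rightarrow>\<^sub>M M \<and> the_inv_into (space M) T \<in> M \<rightarrow>\<^sub>M M \<and>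
    distr M M T = M"

definition L_infinity :: "'a measure \<Rightarrow> ('a \<Rightarrow> real) set" where
  "L_infinity M = {f \<in> borel_measurable M. \<exists>C. AE x in M. \<bar>f x\<bar> \<le> C}"

definition nondegenerate_distr :: "real measure \<Rightarrow> bool" where
  "nondegenerate_distr D \<longleftrightarrow> \<not> (\<exists>c. measure D {c} = 1)"

text \<open>The \<open>\<sigma>\<close>-algebra generated by the real random variables \<open>X j\<close>, \<open>j \<in> J\<close>; trivial for
  empty \<open>J\<close>. Only its sets matter, its measure is the zero measure.\<close>

definition generated_sigma :: "'a measure \<Rightarrow> (nat \<Rightarrow> 'a \<Rightarrow> real) \<Rightarrow> nat set \<Rightarrow> 'a measure" where
  "generated_sigma M X J = sigma (space M) (\<Union>j\<in>J. {X j -` B \<inter> space M |B. B \<in> sets borel})"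

definition martingale_difference_seq :: "'a measure \<Rightarrow> (nat \<Rightarrow> 'a \<Rightarrow> real) \<Rightarrow> bool" where
  "martingale_difference_seq M X \<longleftrightarrow>
    (\<forall>k. integrable M (X k) \<and>
      (AE x in M. real_cond_exp M (generated_sigma M X {j. j < k}) (X k) x = 0))"

definition alpha_coeff :: "'a measure \<Rightarrow> 'a measure \<Rightarrow> 'a measure \<Rightarrow> real" where
  "alpha_coeff M \<U> \<V> =
    Sup {\<bar>measure M (U \<inter> V) - measure M U * measure M V\<bar> |U V. U \<in> sets \<U> \<and> V \<in> sets \<V>}"

definition alpha_mixing_rate :: "'a measure \<Rightarrow> (nat \<Rightarrow> 'a \<Rightarrow> real) \<Rightarrow> nat \<Rightarrow> real" where
  "alpha_mixing_rate M X n =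
    (SUP k. alpha_coeff M (generated_sigma M X {j. j \<le> k}) (generated_sigma M X {j. j \<ge> k + n}))"

definition strongly_mixing :: "'a measure \<Rightarrow> (nat \<Rightarrow> 'a \<Rightarrow> real) \<Rightarrow> bool" where
  "strongly_mixing M X \<longleftrightarrow> alpha_mixing_rate M X \<longlonglongrightarrow> 0"

definition birkhoff_sum :: "('a \<Rightarrow> 'a) \<Rightarrow> ('a \<Rightarrow> real) \<Rightarrow> nat \<Rightarrow> 'a \<Rightarrow> real" where
  "birkhoff_sum T f n x = (\<Sum>k<n. f ((T ^^ k) x))"

definition normalized_cdf :: "'a measure \<Rightarrow> ('a \<Rightarrow> 'a) \<Rightarrow> ('a \<Rightarrow> real) \<Rightarrow> nat \<Rightarrow> real \<Rightarrow> real" where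
  "normalized_cdf M T f n x =
    measure M {\<omega> \<in> space M.
      birkhoff_sum T f n \<omega> \<le> x * sqrt (\<integral>\<omega>. (f \<omega>)\<^sup>2 \<partial>M) * sqrt (real n)}"

end

theory Submission
  imports Defs
begin

text \<open>Let signs \<open>e\<^sub>t\<close> be fair and independent of a stationary 0-1 process \<open>g\<^sub>t\<close>; then \<open>e\<^sub>t g\<^sub>t\<close> is a
  martingale difference sequence (flipping the coin \<open>e\<^sub>k\<close> changes the sign of the term \<open>k\<close> and nothing
  before it), and its partial sum up to \<open>n\<close> vanishes whenever \<open>g\<close> has a zero run of length \<open>n\<close>.
  Take \<open>g\<^sub>t = 0\<close> iff a queue with infinitely many servers, fed by coin tosses, is nonempty at time
  \<open>t\<close>. Customers of kind \<open>k\<close> stay for \<open>2 n\<^sub>k\<close> time units and arrive with probability \<open>p\<^sub>k\<close>, where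
  \<open>n\<^sub>k p\<^sub>k = 2\<^bsup>-k-3\<^esup>\<close>. The load is summable, so removing the past up to time \<open>s\<close> rarely changes what
  happens after \<open>s + n\<close>, which gives strong mixing; but a zero run of length \<open>n\<^sub>k\<close> has probability at
  least \<open>2\<^bsup>-k-4\<^esup>\<close>, which exceeds \<open>a n\<^sub>k\<close> if \<open>n\<^sub>k\<close> grows fast enough. The resulting atom at \<open>0\<close> is a
  jump of the distribution function, which a continuous function misses by half the jump.
  The process is realised on the given space by reading the binary digits of a point of \<open>[0, 1)\<close> as a
  family of coin tosses indexed by \<open>\<int> \<times> \<nat>\<close>, and shifting the first index.\<close>

section \<open>Families of fair coin tosses\<close>

definition coins :: "('i \<Rightarrow> bool) measure" where
  "coins = (\<Pi>\<^sub>M i\<in>UNIV. measure_pmf (pmf_of_set UNIV))"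

definition cylinder :: "'i set \<Rightarrow> ('i \<Rightarrow> bool) \<Rightarrow> ('i \<Rightarrow> bool) set" where
  "cylinder J w = {\<omega>. \<forall>i\<in>J. \<omega> i = w i}"

lemma space_coins [simp]: "space coins = UNIV"
  by (simp add: coins_def space_PiM)

interpretation coins: prob_space "coins :: ('i \<Rightarrow> bool) measure"
  unfolding coins_def by (intro prob_space_PiM measure_pmf.prob_space_axioms)

lemma measurable_coord [measurable]: "(\<lambda>\<omega>. \<omega> i) \<in> coins \<rightarrow>\<^sub>M count_space UNIV"
  using measurable_component_singleton[of i UNIV "\<lambda>_. measure_pmf (pmf_of_set UNIV)"]
  by (simp add: coins_def)

lemma measurable_to_coins:
  assumes "\<And>i. (\<lambda>x. f x i) \<in> M \<rightarrow>\<^sub>M count_space UNIV"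
  shows "f \<in> M \<rightarrow>\<^sub>M coins"
  unfolding coins_def using assms
  by (intro measurable_PiM_single') (auto simp: space_PiM)

lemma sets_cylinder: "finite J \<Longrightarrow> cylinder J w \<in> sets coins"
proof -
  assume J: "finite J"
  have [measurable]: "Measurable.pred coins (\<lambda>\<omega>. \<omega> i = w i)" for i
    by measurable
  have "Measurable.pred coins (\<lambda>\<omega>. \<forall>i\<in>J. \<omega> i = w i)"
    using J by measurable
  then show ?thesis
    by (simp add: cylinder_def pred_def)
qed

lemma emeasure_coins_cylinder:
  assumes "finite J"
  shows "emeasure coins (cylinder J w) = ennreal ((1/2) ^ card J)"
proof -
  interpret product_prob_space "\<lambda>_. measure_pmf (pmf_of_set (UNIV :: bool set))" UNIV
    by unfold_locales
  have "emeasure coins (cylinder J w) = (\<Prod>i\<in>J. emeasure (measure_pmf (pmf_of_set UNIV)) {w i})"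
    using emeasure_PiM_Collect[of J "\<lambda>i. {w i}"] assms
    by (simp add: coins_def cylinder_def space_PiM)
  also have "\<dots> = (\<Prod>i\<in>J. ennreal (1/2))"
    by (simp add: emeasure_pmf_single)
  also have "\<dots> = ennreal ((1/2) ^ card J)"
    by (subst prod_constant, rule ennreal_power) simp
  finally show ?thesis .
qed

lemma measure_coins_cylinder: "finite J \<Longrightarrow> measure coins (cylinder J w) = (1/2) ^ card J"
  by (simp add: measure_def emeasure_coins_cylinder)

lemma cylinder_Int: "cylinder J w \<inter> cylinder K v =
    (if \<forall>i\<in>J \<inter> K. w i = v i then cylinder (J \<union> K) (\<lambda>i. if i \<in> J then w i else v i) else {})"
  by (auto simp: cylinder_def)

text \<open>Cylinders over a directed family of finite coordinate sets that covers every coordinate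
  form an intersection-stable generator, so they determine the measure. The family \<open>JJ\<close>
  is left free because binary digits are easiest to handle on initial segments.\<close>

lemma coins_eqI:
  fixes P :: "('i \<Rightarrow> bool) measure"
  assumes sets: "sets P = sets coins"
    and JJ: "\<And>J. J \<in> JJ \<Longrightarrow> finite J" "\<And>J K. J \<in> JJ \<Longrightarrow> K \<in> JJ \<Longrightarrow> J \<union> K \<in> JJ" "\<Union>JJ = UNIV" "JJ \<noteq> {}"
    and eq: "\<And>J w. J \<in> JJ \<Longrightarrow> emeasure P (cylinder J w) = ennreal ((1/2) ^ card J)"
    and "prob_space P"
  shows "P = coins"
proof -
  interpret P: prob_space P by fact
  \<comment> \<open>Cylinders that prescribe conflicting values are disjoint, hence the extra
    \<open>{}\<close>.\<close>
  define E where "E = insert {} {cylinder J w |J w. J \<in> JJ}"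
  have sub: "E \<subseteq> Pow UNIV"
    by auto
  have stable: "Int_stable E"
  proof (rule Int_stableI)
    fix A B assume "A \<in> E" "B \<in> E"
    then consider "A \<inter> B = {}" | J w K v where "A = cylinder J w" "B = cylinder K v" "J \<in> JJ" "K \<in> JJ"
      by (auto simp: E_def)
    then show "A \<inter> B \<in> E"
    proof cases
      case 2
      then have "cylinder (J \<union> K) u \<in> E" for u
        using JJ(2) by (auto simp: E_def)
      with 2 show ?thesis
        by (simp add: cylinder_Int) (simp add: E_def)
    qed (simp add: E_def)
  qed
  have gen: "sets coins = sigma_sets UNIV E"
  proof
    have "sets coins = sigma_sets UNIV {{f. f i \<in> A} |i A. i \<in> UNIV \<and> A \<in> sets (measure_pmf (pmf_of_set (UNIV :: bool set)))}"
      unfolding coins_def sets_PiM_single by simp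
    also have "\<dots> \<subseteq> sigma_sets UNIV E"
    proof (rule sigma_sets_mono, safe)
      fix i :: 'i and A :: "bool set"
      obtain J where J: "J \<in> JJ" "i \<in> J"
        using JJ(3) by blast
      \<comment> \<open>An event about one coordinate is split by the values on a whole member
        \<open>J\<close> of the family; extensional patterns \<open>w\<close> keep the union
        finite.\<close>
      have "{f. f i \<in> A} = (\<Union>w\<in>{w \<in> Pi\<^sub>E J (\<lambda>_. UNIV). w i \<in> A}. cylinder J w)"
      proof safe
        fix f :: "'i \<Rightarrow> bool" assume "f i \<in> A"
        then show "f \<in> (\<Union>w\<in>{w \<in> Pi\<^sub>E J (\<lambda>_. UNIV). w i \<in> A}. cylinder J w)"
          using J by (intro UN_I[of "restrict f J"]) (auto simp: cylinder_def)
      qed (use J in \<open>auto simp: cylinder_def\<close>)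
      also have "\<dots> \<in> sigma_sets UNIV E"
      proof -
        interpret sigma_algebra UNIV "sigma_sets UNIV E"
          by (rule sigma_algebra_sigma_sets) auto
        have "finite (Pi\<^sub>E J (\<lambda>_. UNIV :: bool set))"
          using J JJ(1) by (intro finite_PiE) auto
        then have "finite {w \<in> Pi\<^sub>E J (\<lambda>_. UNIV :: bool set). w i \<in> A}"
          by (rule rev_finite_subset) blast
        then show ?thesis
          using J by (intro finite_UN) (auto intro!: sigma_sets.Basic simp: E_def)
      qed
      finally show "{f. f i \<in> A} \<in> sigma_sets UNIV E" .
    qed
    finally show "sets coins \<subseteq> sigma_sets UNIV E" .
    show "sigma_sets UNIV E \<subseteq> sets coins"
    proof -
      have "E \<subseteq> sets coins"
        using JJ(1) by (auto simp: E_def intro: sets_cylinder)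
      from sets.sigma_sets_subset[OF this] show ?thesis
        by simp
    qed
  qed
  obtain J0 where "J0 \<in> JJ" using JJ by auto
  show ?thesis
  proof (rule measure_eqI_generator_eq_countable[OF stable sub])
    show "emeasure P X = emeasure coins X" if "X \<in> E" for X
      using that JJ by (auto simp: E_def eq emeasure_coins_cylinder)
    let ?A = "(\<lambda>w. cylinder J0 w) ` Pi\<^sub>E J0 (\<lambda>_. UNIV)"
    show "?A \<subseteq> E"
      using \<open>J0 \<in> JJ\<close> by (auto simp: E_def)
    have "\<omega> \<in> cylinder J0 (restrict \<omega> J0)" for \<omega>
      by (simp add: cylinder_def)
    then show "\<Union>?A = UNIV"
      by fastforce
    show "countable ?A"
      using JJ(1)[OF \<open>J0 \<in> JJ\<close>] by (intro countable_finite finite_imageI finite_PiE) simp_all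
    show "sets P = sigma_sets UNIV E" "sets coins = sigma_sets UNIV E"
      using gen sets by (simp_all only:)
  qed simp
qed

lemma coins_distr_eqI:
  fixes f :: "'a \<Rightarrow> ('i \<Rightarrow> bool)"
  assumes "prob_space P" "f \<in> P \<rightarrow>\<^sub>M coins"
    and "\<And>J w. finite J \<Longrightarrow> emeasure P {x\<in>space P. f x \<in> cylinder J w} = ennreal ((1/2) ^ card J)"
  shows "distr P coins f = coins"
proof (rule coins_eqI[of _ "{J. finite J}"])
  show "\<Union>{J. finite (J :: 'i set)} = UNIV"
    by (auto intro: exI[of _ "{x}" for x])
  show "prob_space (distr P coins f)"
    using assms by (intro prob_space.prob_space_distr)
  fix J w assume "J \<in> {J. finite (J :: 'i set)}"
  then show "emeasure (distr P coins f) (cylinder J w) = ennreal ((1/2) ^ card J)"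
    using assms by (subst emeasure_distr) (auto simp: sets_cylinder vimage_def Int_def conj_commute)
qed auto

section \<open>Measure-preserving maps of coin families, and independence\<close>

lemma distr_coins_reindex:
  assumes "bij p"
  shows "distr coins coins (\<lambda>\<omega> i. \<omega> (p i)) = (coins :: ('i \<Rightarrow> bool) measure)"
proof (rule coins_distr_eqI)
  fix J :: "'i set" and w :: "'i \<Rightarrow> bool" assume "finite J"
  moreover have "{\<omega>. (\<lambda>i. \<omega> (p i)) \<in> cylinder J w} = cylinder (p ` J) (w \<circ> inv p)"
    using assms by (auto simp: cylinder_def bij_is_inj)
  ultimately show "emeasure coins {\<omega>\<in>space coins. (\<lambda>i. \<omega> (p i)) \<in> cylinder J w} = ennreal ((1/2) ^ card J)"
    using assms by (simp add: emeasure_coins_cylinder card_image bij_is_inj inj_on_subset[OF bij_is_inj])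
qed (auto intro!: measurable_to_coins coins.prob_space_axioms)

text \<open>A flip alters the pattern prescribed by a cylinder but not its set of coordinates. This
  symmetry later yields the martingale property.\<close>

lemma distr_coins_flip:
  "distr coins coins (\<lambda>\<omega>. fun_upd \<omega> i (\<not> \<omega> i)) = (coins :: ('i \<Rightarrow> bool) measure)"
proof (rule coins_distr_eqI)
  fix J :: "'i set" and w :: "'i \<Rightarrow> bool" assume "finite J"
  moreover have "{\<omega>. fun_upd \<omega> i (\<not> \<omega> i) \<in> cylinder J w} = cylinder J (fun_upd w i (\<not> w i))"
    by (auto simp: cylinder_def)
  ultimately show "emeasure coins {\<omega>\<in>space coins. fun_upd \<omega> i (\<not> \<omega> i) \<in> cylinder J w} = ennreal ((1/2) ^ card J)"
    by (simp add: emeasure_coins_cylinder)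
next
  show "(\<lambda>\<omega>. fun_upd \<omega> i (\<not> \<omega> i)) \<in> coins \<rightarrow>\<^sub>M coins"
    by (intro measurable_to_coins) (auto simp: fun_upd_def)
qed (rule coins.prob_space_axioms)

text \<open>Splicing two independent families along \<open>A\<close> pulls a cylinder back to a
  rectangle, whose two factors share out the coordinates in \<open>J\<close>.\<close>

lemma distr_coins_merge:
  "distr (coins \<Otimes>\<^sub>M coins) coins (\<lambda>(\<omega>, \<omega>') i. if i \<in> A then \<omega> i else \<omega>' i) =
    (coins :: ('i \<Rightarrow> bool) measure)"
proof (rule coins_distr_eqI)
  interpret P: pair_prob_space "coins :: ('i \<Rightarrow> bool) measure" "coins :: ('i \<Rightarrow> bool) measure" ..
  show "prob_space (coins \<Otimes>\<^sub>M coins :: (('i \<Rightarrow> bool) \<times> ('i \<Rightarrow> bool)) measure)"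
    by (rule P.prob_space_axioms)
  show "(\<lambda>(\<omega>, \<omega>') i. if i \<in> A then \<omega> i else \<omega>' i) \<in> coins \<Otimes>\<^sub>M coins \<rightarrow>\<^sub>M coins"
    by (intro measurable_to_coins) (auto simp: case_prod_unfold intro: measurable_compose[OF measurable_fst] measurable_compose[OF measurable_snd])
  fix J :: "'i set" and w :: "'i \<Rightarrow> bool" assume J: "finite J"
  have "{x\<in>space (coins \<Otimes>\<^sub>M coins). (case x of (\<omega>, \<omega>') \<Rightarrow> \<lambda>i. if i \<in> A then \<omega> i else \<omega>' i) \<in> cylinder J w} =
      cylinder (J \<inter> A) w \<times> cylinder (J - A) w"
    by (auto simp: cylinder_def space_pair_measure)
  then have "emeasure (coins \<Otimes>\<^sub>M coins) {x\<in>space (coins \<Otimes>\<^sub>M coins). (case x of (\<omega>, \<omega>') \<Rightarrow> \<lambda>i. if i \<in> A then \<omega> i else \<omega>' i) \<in> cylinder J w} =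
      ennreal ((1/2) ^ card (J \<inter> A) * (1/2) ^ card (J - A))"
    using J by (simp add: coins.emeasure_pair_measure_Times sets_cylinder emeasure_coins_cylinder ennreal_mult)
  also have "\<dots> = ennreal ((1/2) ^ card J)"
    using J by (simp add: card_Int_Diff[of J A] power_add)
  finally show "emeasure (coins \<Otimes>\<^sub>M coins) {x\<in>space (coins \<Otimes>\<^sub>M coins). (case x of (\<omega>, \<omega>') \<Rightarrow> \<lambda>i. if i \<in> A then \<omega> i else \<omega>' i) \<in> cylinder J w} = ennreal ((1/2) ^ card J)" .
qed

text \<open>One implication suffices, since the two families can be exchanged.\<close>

definition determined_by :: "'i set \<Rightarrow> ('i \<Rightarrow> bool) set \<Rightarrow> bool" where
  "determined_by J A \<longleftrightarrow> (\<forall>\<omega> \<omega>'. (\<forall>i\<in>J. \<omega> i = \<omega>' i) \<longrightarrow> \<omega> \<in> A \<longrightarrow> \<omega>' \<in> A)"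

text \<open>After splicing along \<open>J\<close>, the event \<open>A\<close> depends on the first
  family only and \<open>B\<close> on the second, so the intersection pulls back to the rectangle
  \<open>A \<times> B\<close>.\<close>

lemma coins_indep:
  fixes A B :: "('i \<Rightarrow> bool) set"
  assumes [measurable]: "A \<in> sets coins" "B \<in> sets coins"
    and J: "determined_by J A" "determined_by (- J) B"
  shows "measure coins (A \<inter> B) = measure coins A * measure coins B"
proof -
  let ?m = "\<lambda>(\<omega>, \<omega>') i. if i \<in> J then \<omega> i else (\<omega>' i :: bool)"
  have m: "?m \<in> coins \<Otimes>\<^sub>M coins \<rightarrow>\<^sub>M coins"
    by (intro measurable_to_coins) (auto simp: case_prod_unfold intro: measurable_compose[OF measurable_fst] measurable_compose[OF measurable_snd])
  have 1: "?m (\<omega>, \<omega>') \<in> A \<longleftrightarrow> \<omega> \<in> A" for \<omega> \<omega>'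
  proof
    assume *: "?m (\<omega>, \<omega>') \<in> A"
    show "\<omega> \<in> A" by (rule J(1)[unfolded determined_by_def, rule_format, OF _ *]) auto
  next
    assume *: "\<omega> \<in> A"
    show "?m (\<omega>, \<omega>') \<in> A" by (rule J(1)[unfolded determined_by_def, rule_format, OF _ *]) auto
  qed
  have 2: "?m (\<omega>, \<omega>') \<in> B \<longleftrightarrow> \<omega>' \<in> B" for \<omega> \<omega>'
  proof
    assume *: "?m (\<omega>, \<omega>') \<in> B"
    show "\<omega>' \<in> B" by (rule J(2)[unfolded determined_by_def, rule_format, OF _ *]) auto
  next
    assume *: "\<omega>' \<in> B"
    show "?m (\<omega>, \<omega>') \<in> B" by (rule J(2)[unfolded determined_by_def, rule_format, OF _ *]) auto
  qed
  have "measure coins (A \<inter> B) = measure (distr (coins \<Otimes>\<^sub>M coins) coins ?m) (A \<inter> B)"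
    by (simp add: distr_coins_merge)
  also have "\<dots> = measure (coins \<Otimes>\<^sub>M coins) (?m -` (A \<inter> B) \<inter> space (coins \<Otimes>\<^sub>M coins))"
    using m by (intro measure_distr) auto
  also have "?m -` (A \<inter> B) \<inter> space (coins \<Otimes>\<^sub>M coins) = A \<times> B"
  proof -
    have "z \<in> ?m -` (A \<inter> B) \<longleftrightarrow> z \<in> A \<times> B" for z
      by (cases z) (use 1 2 in \<open>simp only: vimage_eq Int_iff mem_Times_iff fst_conv snd_conv\<close>)
    moreover have "space (coins \<Otimes>\<^sub>M coins :: (('i \<Rightarrow> bool) \<times> ('i \<Rightarrow> bool)) measure) = UNIV"
      by (simp add: space_pair_measure)
    ultimately show ?thesis by blast
  qed
  also have "measure (coins \<Otimes>\<^sub>M coins) (A \<times> B) = measure coins A * measure coins B"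
    by (simp add: measure_def coins.emeasure_pair_measure_Times enn2real_mult)
  finally show ?thesis .
qed

section \<open>Binary digits\<close>

text \<open>The digit of weight \<open>1 / 2 ^ Suc i\<close>. The floor selects the terminating
  expansion at dyadic rationals.\<close>

definition digit :: "nat \<Rightarrow> real \<Rightarrow> bool" where
  "digit i x \<longleftrightarrow> odd \<lfloor>2 ^ Suc i * x\<rfloor>"

lemma floor_digit_Suc: "\<lfloor>2 ^ Suc n * x\<rfloor> = 2 * \<lfloor>2 ^ n * x\<rfloor> + of_bool (digit n x)"
proof -
  define y where "y = 2 ^ n * x"
  have "\<lfloor>2 * y\<rfloor> = 2 * \<lfloor>y\<rfloor> \<or> \<lfloor>2 * y\<rfloor> = 2 * \<lfloor>y\<rfloor> + 1"
    by linarith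
  moreover have "2 ^ Suc n * x = 2 * y"
    by (simp add: y_def)
  ultimately show ?thesis
    unfolding digit_def \<open>2 ^ Suc n * x = 2 * y\<close> y_def[symmetric] by auto
qed

fun digit_prefix :: "(nat \<Rightarrow> bool) \<Rightarrow> nat \<Rightarrow> int" where
  "digit_prefix w 0 = 0"
| "digit_prefix w (Suc n) = 2 * digit_prefix w n + of_bool (w n)"

text \<open>Doubling appends one digit to the floor and parity recovers it, so the equation for
  \<open>Suc n\<close> splits into the one for \<open>n\<close> and one digit. At
  \<open>n = 0\<close> it says that the floor of \<open>x\<close> is 0, which is where the unit
  interval enters.\<close>

lemma floor_eq_digit_prefix_iff:
  "\<lfloor>2 ^ n * x\<rfloor> = digit_prefix w n \<longleftrightarrow> x \<in> {0..<1} \<and> (\<forall>i<n. digit i x = w i)"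
proof (induction n)
  case 0
  then show ?case
    by (auto simp: floor_eq_iff)
next
  case (Suc n)
  have "\<lfloor>2 ^ Suc n * x\<rfloor> = digit_prefix w (Suc n) \<longleftrightarrow> \<lfloor>2 ^ n * x\<rfloor> = digit_prefix w n \<and> digit n x = w n"
    unfolding floor_digit_Suc by (auto simp: of_bool_def) presburger+
  with Suc show ?case
    by (auto simp: less_Suc_eq)
qed

text \<open>The set is the dyadic interval of length \<open>(1/2) ^ n\<close> that starts at
  \<open>digit_prefix w n / 2 ^ n\<close>.\<close>

lemma emeasure_digit_cylinder:
  "emeasure lborel {x \<in> {0..<1}. \<forall>i<n. digit i x = w i} = ennreal ((1/2) ^ n)"
proof -
  define m where "m = real_of_int (digit_prefix w n)"
  have "{x \<in> {0..<1}. \<forall>i<n. digit i x = w i} = {m / 2 ^ n..<(m + 1) / 2 ^ n}"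
    using floor_eq_digit_prefix_iff[of n _ w]
    by (auto simp: floor_eq_iff m_def field_simps)
  moreover have "m / 2 ^ n \<le> (m + 1) / 2 ^ n"
    by (simp add: divide_right_mono)
  ultimately show ?thesis
    by (simp add: diff_divide_distrib[symmetric] power_one_over)
qed

text \<open>The partial sums are dyadic truncations of \<open>x\<close> and lie within
  \<open>(1/2) ^ n\<close> of it.\<close>

lemma digit_sums:
  assumes x: "x \<in> {0..<1}"
  shows "(\<lambda>i. of_bool (digit i x) / 2 ^ Suc i) sums x"
proof -
  have sum: "(\<Sum>i<n. of_bool (digit i x) / 2 ^ Suc i) = of_int \<lfloor>2 ^ n * x\<rfloor> / (2 ^ n :: real)" for n
  proof (induction n)
    case 0
    have "\<lfloor>x\<rfloor> = 0" using x by (auto simp: floor_eq_iff)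
    then show ?case by simp
  next
    case (Suc n)
    then show ?case
      unfolding floor_digit_Suc by (simp add: field_simps)
  qed
  have "(\<lambda>n. of_int \<lfloor>2 ^ n * x\<rfloor> / (2 ^ n :: real)) \<longlonglongrightarrow> x"
  proof (rule tendsto_sandwich[of "\<lambda>n. x - (1/2) ^ n" _ _ "\<lambda>_. x"])
    show "\<forall>\<^sub>F n in sequentially. x - (1/2) ^ n \<le> of_int \<lfloor>2 ^ n * x\<rfloor> / (2 ^ n :: real)"
    proof (intro always_eventually allI)
      fix n
      have "2 ^ n * x - 1 \<le> of_int \<lfloor>2 ^ n * x\<rfloor>" by linarith
      then have "(2 ^ n * x - 1) / 2 ^ n \<le> of_int \<lfloor>2 ^ n * x\<rfloor> / (2 ^ n :: real)"
        by (intro divide_right_mono) auto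
      then show "x - (1/2) ^ n \<le> of_int \<lfloor>2 ^ n * x\<rfloor> / (2 ^ n :: real)"
        by (simp add: diff_divide_distrib power_one_over)
    qed
    show "\<forall>\<^sub>F n in sequentially. of_int \<lfloor>2 ^ n * x\<rfloor> / (2 ^ n :: real) \<le> x"
      by (intro always_eventually allI) (simp add: divide_le_eq mult.commute)
    have "(\<lambda>n. x - (1/2) ^ n) \<longlonglongrightarrow> x - 0"
      by (intro tendsto_intros LIMSEQ_realpow_zero) auto
    then show "(\<lambda>n. x - (1/2) ^ n) \<longlonglongrightarrow> x" by simp
  qed auto
  then show ?thesis
    by (simp only: sums_def sum)
qed

text \<open>The binary digits of a uniform point are fair coins. \<open>V\<close> is only a left
  inverse of \<open>D\<close>, because digit sequences that end in ones are not attained.\<close>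

lemma unit_interval_coins:
  fixes enc :: "'i \<Rightarrow> nat"
  assumes enc: "bij enc"
  obtains D :: "real \<Rightarrow> 'i \<Rightarrow> bool" and V :: "('i \<Rightarrow> bool) \<Rightarrow> real"
  where "D \<in> borel \<rightarrow>\<^sub>M coins" "V \<in> coins \<rightarrow>\<^sub>M borel" "\<And>x. x \<in> {0..<1} \<Longrightarrow> V (D x) = x"
    "distr (restrict_space lborel {0..<1}) coins D = coins"
proof
  let ?D = "\<lambda>x p. digit (enc p) x"
  let ?U = "restrict_space lborel {0..<1::real}"
  show D: "?D \<in> borel \<rightarrow>\<^sub>M coins"
    unfolding digit_def by (intro measurable_to_coins) measurable
  show "(\<lambda>\<omega>. \<Sum>i. of_bool (\<omega> (inv enc i)) / 2 ^ Suc i :: real) \<in> coins \<rightarrow>\<^sub>M borel"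
    by measurable
  show "(\<Sum>i. of_bool (digit (enc (inv enc i)) x) / 2 ^ Suc i) = x" if "x \<in> {0..<1}" for x
    using digit_sums[OF that] enc by (simp add: bij_is_surj surj_f_inv_f sums_iff)
  have U: "prob_space ?U"
    by (intro prob_spaceI) (simp add: emeasure_restrict_space)
  have D': "?D \<in> ?U \<rightarrow>\<^sub>M coins"
    using D by (intro measurable_restrict_space1) simp
  \<comment> \<open>On an initial segment of digits each cylinder is a single dyadic interval, so
    \<open>JJ\<close> consists of the preimages of initial segments under
    \<open>enc\<close>.\<close>
  show "distr ?U coins ?D = coins"
  proof (rule coins_eqI[of _ "range (\<lambda>n. enc -` {..<n})"])
    show "prob_space (distr ?U coins ?D)"
      using U D' by (intro prob_space.prob_space_distr)
    show "J \<union> K \<in> range (\<lambda>n. enc -` {..<n})"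
      if JK: "J \<in> range (\<lambda>n. enc -` {..<n})" "K \<in> range (\<lambda>n. enc -` {..<n})" for J K
    proof -
      obtain m n where "J = enc -` {..<m}" "K = enc -` {..<n}"
        using JK by auto
      then have "J \<union> K = enc -` {..<max m n}"
        by auto
      then show ?thesis by blast
    qed
    fix J and w :: "'i \<Rightarrow> bool"
    assume "J \<in> range (\<lambda>n. enc -` {..<n})"
    then obtain n where J: "J = enc -` {..<n}" by auto
    have fin: "finite J" and card: "card J = n"
      using enc by (auto simp: J bij_def finite_vimageI card_vimage_inj)
    have "emeasure (distr ?U coins ?D) (cylinder J w) = emeasure ?U (?D -` cylinder J w \<inter> {0..<1})"
      using D' fin by (subst emeasure_distr) (auto simp: sets_cylinder)
    also have "\<dots> = emeasure lborel (?D -` cylinder J w \<inter> {0..<1})"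
      by (intro emeasure_restrict_space) auto
    also have "?D -` cylinder J w \<inter> {0..<1} = {x \<in> {0..<1}. \<forall>i<n. digit i x = w (inv enc i)}"
    proof -
      have "inv enc (enc p) = p" "enc (inv enc i) = i" for p i
        using enc by (simp_all add: bij_is_inj bij_is_surj surj_f_inv_f)
      then have "(\<forall>p\<in>J. digit (enc p) x = w p) \<longleftrightarrow> (\<forall>i<n. digit i x = w (inv enc i))" for x
        unfolding J vimage_def lessThan_iff mem_Collect_eq Ball_def by metis
      then show ?thesis
        by (auto simp: cylinder_def)
    qed
    finally show "emeasure (distr ?U coins ?D) (cylinder J w) = ennreal ((1/2) ^ card J)"
      by (simp only: emeasure_digit_cylinder card)
    show "finite J"
      by (rule fin)
  next
    have "x \<in> enc -` {..<Suc (enc x)}" for x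
      by simp
    then show "\<Union> (range (\<lambda>n. enc -` {..<n})) = UNIV"
      by blast
  qed auto
qed

section \<open>Coding a Lebesgue space by coin tosses\<close>

text \<open>\<open>T\<close> is \<open>\<sigma>\<close> conjugated by \<open>\<psi>\<close>. A set
  of the complete space \<open>M\<close> need not be a pullback from \<open>N\<close>, but it is
  sandwiched on \<open>Good\<close> between pullbacks of equal measure. Applying
  \<open>\<sigma>\<close> keeps the two measures equal, so the preimage under \<open>T\<close> is
  sandwiched as well and completeness makes it measurable.\<close>

lemma transported_map:
  fixes M :: "'a measure" and N :: "'b measure" and \<psi> :: "'a \<Rightarrow> 'b"
  assumes M: "complete_measure M" "prob_space M"
    and Good: "Good \<in> sets M" "emeasure M (space M - Good) = 0"
    and \<psi>: "bij_betw \<psi> Good G"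
    and pres: "\<And>E. E \<in> sets N \<Longrightarrow> \<psi> -` E \<inter> Good \<in> sets M"
      "\<And>E. E \<in> sets N \<Longrightarrow> emeasure M (\<psi> -` E \<inter> Good) = emeasure N E"
    and approx: "\<And>A. A \<in> sets M \<Longrightarrow> \<exists>E\<in>sets N. \<exists>F\<in>sets N. emeasure N E = emeasure N F \<and>
      \<psi> -` E \<inter> Good \<subseteq> A \<and> A \<inter> Good \<subseteq> \<psi> -` F"
    and \<sigma>: "\<sigma> \<in> N \<rightarrow>\<^sub>M N" "distr N N \<sigma> = N" "\<sigma> ` G \<subseteq> G" "G \<subseteq> space N"
  defines "T \<equiv> \<lambda>x. if x \<in> Good then inv_into Good \<psi> (\<sigma> (\<psi> x)) else x"
  shows "T \<in> M \<rightarrow>\<^sub>M M" "distr M M T = M"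
proof -
  interpret complete_measure M by fact
  interpret prob_space M by fact
  have GoodM: "Good \<subseteq> space M"
    using Good sets.sets_into_space by auto
  have T_Good: "T x \<in> Good \<and> \<psi> (T x) = \<sigma> (\<psi> x)" if "x \<in> Good" for x
  proof -
    have "\<sigma> (\<psi> x) \<in> \<psi> ` Good"
      using that \<psi> \<sigma>(3) by (auto simp: bij_betw_def)
    then show ?thesis
      using that by (auto simp: T_def inv_into_into f_inv_into_f)
  qed
  have T_space: "T \<in> space M \<rightarrow> space M"
  proof
    fix x assume "x \<in> space M"
    then show "T x \<in> space M"
      using T_Good[of x] GoodM by (cases "x \<in> Good") (auto simp: T_def)
  qed
  have N_vimage: "\<sigma> -` E \<inter> space N \<in> sets N" "emeasure N (\<sigma> -` E \<inter> space N) = emeasure N E"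
    if "E \<in> sets N" for E
    using that \<sigma> measurable_sets[OF \<sigma>(1) that] emeasure_distr[OF \<sigma>(1) that] by auto
  have *: "T -` A \<inter> space M \<in> sets M \<and> emeasure M (T -` A \<inter> space M) = emeasure M A" if A: "A \<in> sets M" for A
  proof -
    obtain E F where EF: "E \<in> sets N" "F \<in> sets N" "emeasure N E = emeasure N F"
        "\<psi> -` E \<inter> Good \<subseteq> A" "A \<inter> Good \<subseteq> \<psi> -` F"
      using approx[OF A] by auto
    define E' F' where "E' = \<sigma> -` E \<inter> space N" and "F' = \<sigma> -` F \<inter> space N"
    have E'F': "E' \<in> sets N" "F' \<in> sets N" "emeasure N E' = emeasure N E" "emeasure N F' = emeasure N E"
      using EF N_vimage by (auto simp: E'_def F'_def)
    define B where "B = T -` A \<inter> Good"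
    have sub: "\<psi> -` E' \<inter> Good \<subseteq> B" "B \<subseteq> \<psi> -` F' \<inter> Good"
    proof -
      show "\<psi> -` E' \<inter> Good \<subseteq> B"
        using EF(4) T_Good by (auto simp: B_def E'_def)
      show "B \<subseteq> \<psi> -` F' \<inter> Good"
      proof
        fix x assume "x \<in> B"
        then have "x \<in> Good" "T x \<in> A"
          by (auto simp: B_def)
        then have "\<psi> (T x) \<in> F" "\<psi> x \<in> space N"
          using T_Good[of x] EF(5) \<psi> \<sigma>(4) by (auto simp: bij_betw_def)
        then show "x \<in> \<psi> -` F' \<inter> Good"
          using T_Good[OF \<open>x \<in> Good\<close>] \<open>x \<in> Good\<close> by (auto simp: F'_def)
      qed
    qed
    have "emeasure N E \<noteq> \<top>"
      using pres(2)[OF EF(1)] emeasure_finite by (metis infinity_ennreal_def)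
    then have B: "B \<in> sets M"
      using E'F' sub pres by (intro complete_sets_sandwich[OF _ _ sub]) (auto simp: less_top[symmetric])
    have "emeasure M (\<psi> -` E' \<inter> Good) \<le> emeasure M B" "emeasure M B \<le> emeasure M (\<psi> -` F' \<inter> Good)"
      using emeasure_mono[OF sub(1) B] emeasure_mono[OF sub(2)] pres(1)[OF E'F'(2)] by auto
    then have emB: "emeasure M B = emeasure N E"
      using E'F' pres by auto
    have AG: "A \<inter> Good \<in> sets M"
      using A Good by auto
    have "emeasure M (\<psi> -` E \<inter> Good) \<le> emeasure M (A \<inter> Good)" "emeasure M (A \<inter> Good) \<le> emeasure M (\<psi> -` F \<inter> Good)"
      using EF(4,5) pres(1)[OF EF(2)] AG by (intro emeasure_mono; blast)+
    then have emA: "emeasure M (A \<inter> Good) = emeasure N E"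
      using EF(1-3) pres(2) by (intro antisym) simp_all
    have "space M - Good \<in> null_sets M"
      using Good by (intro null_setsI sets.compl_sets)
    then have null: "A - Good \<in> null_sets M"
      by (rule complete2[rotated]) (use sets.sets_into_space[OF A] in blast)
    \<comment> \<open>\<open>T\<close> is the identity off \<open>Good\<close>, so the remaining
      part of the preimage is a null set.\<close>
    have eq: "T -` A \<inter> space M = B \<union> (A - Good)"
      using GoodM sets.sets_into_space[OF A] by (auto simp: B_def T_def split: if_splits)
    have "emeasure M (T -` A \<inter> space M) = emeasure M B"
      unfolding eq using null B by (rule emeasure_Un_null_set[rotated])
    also have "\<dots> = emeasure M ((A \<inter> Good) \<union> (A - Good))"
      using emeasure_Un_null_set[OF AG null] by (simp add: emA emB)
    also have "(A \<inter> Good) \<union> (A - Good) = A" by auto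
    finally show ?thesis
      using sets.Un[OF B null_setsD2[OF null]] unfolding eq by blast
  qed
  show T: "T \<in> M \<rightarrow>\<^sub>M M"
    using * T_space by (auto intro!: measurableI)
  show "distr M M T = M"
    by (rule measure_eqI) (use * T in \<open>auto simp: emeasure_distr\<close>)
qed

text \<open>Non-atomicity removes the point masses and the total mass fixes the length of the
  interval. The claim about images records that the inverse isomorphism is measurable.\<close>

lemma lebesgue_prob_space_interval:
  fixes M :: "'a measure"
  assumes "lebesgue_prob_space M" "non_atomic M"
  obtains A B \<phi> where "A \<in> null_sets M" "B \<in> null_sets lborel"
    "\<phi> \<in> space M - A \<rightarrow> {0..1::real}" "inj_on \<phi> (space M - A)" "{0..1} - B \<subseteq> \<phi> ` (space M - A)"
    "\<And>P. P \<in> sets borel \<Longrightarrow> P \<subseteq> {0..1} - B \<Longrightarrow>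
      \<phi> -` P \<inter> (space M - A) \<in> sets M \<and> emeasure M (\<phi> -` P \<inter> (space M - A)) = emeasure lborel P"
    "\<And>W. W \<in> sets M \<Longrightarrow> W \<subseteq> space M - A \<Longrightarrow> \<phi> ` W \<in> sets lebesgue"
proof -
  interpret prob_space M
    using assms by (simp add: lebesgue_prob_space_def)
  obtain C s where C: "\<And>c. c \<in> C \<Longrightarrow> {c} \<in> sets M \<and> emeasure M {c} > 0" and s: "s \<ge> 0"
    and iso: "isomorphic_mod0 (restrict_space M (space M - C)) (lebesgue_on {0..s::real})"
    using assms(1) unfolding lebesgue_prob_space_def by blast
  \<comment> \<open>The only subsets of a singleton are itself and the empty set, so a point of
    positive mass is an atom.\<close>
  have "C = {}"
  proof (rule ccontr)
    assume "C \<noteq> {}"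
    then obtain c where "{c} \<in> sets M" "emeasure M {c} > 0"
      using C by auto
    then obtain B where "B \<subseteq> {c}" "0 < emeasure M B" "emeasure M B < emeasure M {c}"
      using assms(2) unfolding non_atomic_def by blast
    then show False
      by (auto simp: subset_singleton_iff)
  qed
  have "restrict_space M (space M) = M"
    by (rule measure_eqI)
      (auto simp: sets_restrict_space emeasure_restrict_space sets.sets_into_space image_iff
        dest: sets.sets_into_space intro!: exI)
  with iso \<open>C = {}\<close> have iso: "isomorphic_mod0 M (lebesgue_on {0..s})"
    by simp
  define L where "L = lebesgue_on {0..s}"
  obtain A B \<phi> where A: "A \<in> null_sets M" and B: "B \<in> null_sets L"
    and bij: "bij_betw \<phi> (space M - A) ({0..s} - B)"
    and \<phi>: "\<phi> \<in> restrict_space M (space M - A) \<rightarrow>\<^sub>M restrict_space L ({0..s} - B)"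
    and inv: "the_inv_into (space M - A) \<phi> \<in> restrict_space L ({0..s} - B) \<rightarrow>\<^sub>M restrict_space M (space M - A)"
    and distr: "distr (restrict_space M (space M - A)) (restrict_space L ({0..s} - B)) \<phi> = restrict_space L ({0..s} - B)"
    using iso unfolding isomorphic_mod0_def Let_def
    by (auto simp: space_restrict_space L_def Int_absorb2 Diff_subset)
  have sA: "space M - A \<in> sets M"
    using A by auto
  have sB: "B \<in> sets lebesgue" "B \<subseteq> {0..s}" "emeasure lebesgue B = 0"
    using B by (auto simp: L_def null_sets_def sets_restrict_space emeasure_restrict_space)
  have L: "restrict_space L ({0..s} - B) = lebesgue_on ({0..s} - B)"
    using sB unfolding L_def by (subst restrict_restrict_space) (auto simp: Int_absorb1)
  have emL: "emeasure (restrict_space L ({0..s} - B)) P = emeasure lebesgue P" if "P \<subseteq> {0..s} - B" for P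
    using that sB unfolding L by (intro emeasure_restrict_space) auto
  have setsL: "P \<in> sets (restrict_space L ({0..s} - B)) \<longleftrightarrow> P \<in> sets lebesgue \<and> P \<subseteq> {0..s} - B" for P
    using sB unfolding L by (subst sets_restrict_space_iff) auto
  have pres: "\<phi> -` P \<inter> (space M - A) \<in> sets M \<and> emeasure M (\<phi> -` P \<inter> (space M - A)) = emeasure lebesgue P"
    if "P \<in> sets lebesgue" "P \<subseteq> {0..s} - B" for P
  proof -
    have P: "P \<in> sets (restrict_space L ({0..s} - B))"
      using that setsL by simp
    have "\<phi> -` P \<inter> (space M - A) \<in> sets (restrict_space M (space M - A))"
      using measurable_sets[OF \<phi> P] sA by (simp add: space_restrict_space)
    moreover have "emeasure M (\<phi> -` P \<inter> (space M - A)) = emeasure (restrict_space M (space M - A)) (\<phi> -` P \<inter> (space M - A))"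
      using sA by (subst emeasure_restrict_space) auto
    moreover have "\<dots> = emeasure (distr (restrict_space M (space M - A)) (restrict_space L ({0..s} - B)) \<phi>) P"
      using sA by (subst emeasure_distr[OF \<phi> P]) (simp add: space_restrict_space)
    ultimately show ?thesis
      using distr emL[OF that(2)] sA by (simp add: sets_restrict_space_iff)
  qed
  \<comment> \<open>The isomorphism preserves total mass, which forces \<open>s = 1\<close>.\<close>
  have "ennreal s = emeasure lebesgue ({0..s} - B)"
    using sB s by (subst emeasure_Diff) (auto simp: )
  also have "\<dots> = emeasure M (\<phi> -` ({0..s} - B) \<inter> (space M - A))"
    using pres[OF _ subset_refl] sB(1) by (simp only: sets.Diff lmeasurable_interval fmeasurableD)
  also have "\<phi> -` ({0..s} - B) \<inter> (space M - A) = space M - A"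
    using bij by (auto simp: bij_betw_def)
  also have "emeasure M (space M - A) = 1"
    using A by (simp add: emeasure_Diff_null_set emeasure_space_1)
  finally have "s = 1"
    using s by (simp add: ennreal_eq_1)
  from sB have "B \<in> null_sets lebesgue"
    by (auto simp: null_sets_def)
  \<comment> \<open>Enlarging the exceptional set to a Borel null set keeps the later constructions
    Borel measurable.\<close>
  then obtain B' where B': "B' \<in> null_sets lborel" "B \<subseteq> B'"
    by (auto simp: null_sets_completion_iff2)
  show thesis
  proof
    show "\<phi> \<in> space M - A \<rightarrow> {0..1}" "inj_on \<phi> (space M - A)" "{0..1} - B' \<subseteq> \<phi> ` (space M - A)"
      using bij B'(2) \<open>s = 1\<close> by (auto simp: bij_betw_def)
    show "\<phi> -` P \<inter> (space M - A) \<in> sets M \<and> emeasure M (\<phi> -` P \<inter> (space M - A)) = emeasure lborel P"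
      if "P \<in> sets borel" "P \<subseteq> {0..1} - B'" for P
      using pres[of P] that B'(2) \<open>s = 1\<close> by auto
    show "\<phi> ` W \<in> sets lebesgue" if W: "W \<in> sets M" "W \<subseteq> space M - A" for W
    proof -
      have "W \<in> sets (restrict_space M (space M - A))"
        using W sA by (simp add: sets_restrict_space_iff)
      from measurable_sets[OF inv this]
      have "the_inv_into (space M - A) \<phi> -` W \<inter> ({0..s} - B) \<in> sets (restrict_space L ({0..s} - B))"
        by (simp add: space_restrict_space L_def Int_absorb2 Diff_subset)
      moreover have "the_inv_into (space M - A) \<phi> -` W \<inter> ({0..s} - B) = \<phi> ` W"
      proof (intro set_eqI iffI)
        fix y assume y: "y \<in> the_inv_into (space M - A) \<phi> -` W \<inter> ({0..s} - B)"
        then have "\<phi> (the_inv_into (space M - A) \<phi> y) = y"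
          using bij by (intro f_the_inv_into_f_bij_betw[OF bij]) blast
        moreover have "the_inv_into (space M - A) \<phi> y \<in> W"
          using y by blast
        ultimately show "y \<in> \<phi> ` W"
          by (metis imageI)
      next
        fix y assume "y \<in> \<phi> ` W"
        then obtain x where x: "x \<in> W" "y = \<phi> x"
          by blast
        then have "the_inv_into (space M - A) \<phi> y = x"
          using W(2) bij by (auto simp: bij_betw_def the_inv_into_f_f)
        moreover have "y \<in> {0..s} - B"
          using bij_betw_apply[OF bij] x W(2) by blast
        ultimately show "y \<in> the_inv_into (space M - A) \<phi> -` W \<inter> ({0..s} - B)"
          using x(1) by blast
      qed
      ultimately show ?thesis
        using setsL by simp
    qed
  qed (use A B' in auto)
qed

text \<open>Up to null sets, \<open>M\<close> is carried by \<open>\<phi>\<close> and then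
  \<open>D\<close> onto a set of coin families of full measure; permuting coordinates there and
  conjugating back gives \<open>T\<close>. Invariance of that set under \<open>p\<close> and its
  inverse makes \<open>T\<close> a bijection of the whole space and the coding equivariant at every
  point.\<close>

lemma complete_lebesgue_prob_space_coding:
  fixes M :: "'a measure" and enc :: "'i \<Rightarrow> nat" and p :: "'i \<Rightarrow> 'i"
  assumes M: "lebesgue_prob_space M" "non_atomic M" and enc: "bij enc" and p: "bij p"
  obtains T \<beta> where "mp_automorphism M T" "\<beta> \<in> M \<rightarrow>\<^sub>M coins" "distr M coins \<beta> = coins"
    "\<And>x. x \<in> space M \<Longrightarrow> \<beta> (T x) = \<beta> x \<circ> p"
proof -
  have "complete_measure M" "prob_space M"
    using M by (auto simp: lebesgue_prob_space_def)
  interpret prob_space M by fact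
  obtain A B \<phi> where A: "A \<in> null_sets M" and B: "B \<in> null_sets lborel"
    and \<phi>: "\<phi> \<in> space M - A \<rightarrow> {0..1::real}" "inj_on \<phi> (space M - A)" "{0..1} - B \<subseteq> \<phi> ` (space M - A)"
    and pres: "\<And>P. P \<in> sets borel \<Longrightarrow> P \<subseteq> {0..1} - B \<Longrightarrow>
      \<phi> -` P \<inter> (space M - A) \<in> sets M \<and> emeasure M (\<phi> -` P \<inter> (space M - A)) = emeasure lborel P"
    and image: "\<And>W. W \<in> sets M \<Longrightarrow> W \<subseteq> space M - A \<Longrightarrow> \<phi> ` W \<in> sets lebesgue"
    using lebesgue_prob_space_interval[OF M] by metis
  obtain D :: "real \<Rightarrow> 'i \<Rightarrow> bool" and V where DV [measurable]: "D \<in> borel \<rightarrow>\<^sub>M coins" "V \<in> coins \<rightarrow>\<^sub>M borel"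
    and VD: "\<And>x. x \<in> {0..<1} \<Longrightarrow> V (D x) = x"
    and distr_D: "distr (restrict_space lborel {0..<1}) coins D = coins"
    using unit_interval_coins[OF enc] by metis
  let ?U = "restrict_space lborel {0..<1::real}"
  have D_U [measurable]: "D \<in> ?U \<rightarrow>\<^sub>M coins"
    by (intro measurable_restrict_space1) simp
  have [measurable]: "B \<in> sets borel"
    using B by auto
  have emeasure_coins: "emeasure coins E = emeasure lborel {x \<in> {0..<1}. D x \<in> E}" if [measurable]: "E \<in> sets coins" for E
  proof -
    have "emeasure coins E = emeasure (distr ?U coins D) E"
      by (simp add: distr_D)
    also have "\<dots> = emeasure lborel (D -` E \<inter> {0..<1})"
      by (subst emeasure_distr) (auto simp: emeasure_restrict_space)
    also have "D -` E \<inter> {0..<1} = {x \<in> {0..<1}. D x \<in> E}" by auto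
    finally show ?thesis .
  qed

  \<comment> \<open>The image of \<open>D\<close>, cut down to a set on which \<open>D\<close>, \<open>V\<close> and \<open>\<phi>\<close> match up; \<open>G\<close> below is its largest
    subset invariant under the coordinate permutation.\<close>
  define G1 where "G1 = {\<omega>. V \<omega> \<in> {0..<1} \<and> V \<omega> \<notin> B \<and> (\<forall>n. D (V \<omega>) (inv enc n) = \<omega> (inv enc n))}"
  have "Measurable.pred coins (\<lambda>\<omega>. V \<omega> \<in> {0..<1} \<and> V \<omega> \<notin> B \<and> (\<forall>n. D (V \<omega>) (inv enc n) = \<omega> (inv enc n)))"
  proof -
    have [measurable]: "(\<lambda>\<omega>. D (V \<omega>) i) \<in> coins \<rightarrow>\<^sub>M count_space UNIV" for i
      using measurable_compose[OF measurable_compose[OF DV(2,1)] measurable_coord] .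
    show ?thesis by measurable
  qed
  then have G1 [measurable]: "G1 \<in> sets coins"
    by (simp add: pred_def G1_def)
  have G1_D: "D (V \<omega>) = \<omega>" if "\<omega> \<in> G1" for \<omega>
  proof
    fix i
    have "inv enc (enc i) = i" using enc by (simp add: bij_is_inj)
    with that show "D (V \<omega>) i = \<omega> i"
      unfolding G1_def by (metis (mono_tags, lifting) mem_Collect_eq)
  qed
  have AE_G1: "AE \<omega> in coins. \<omega> \<in> G1"
  proof -
    have "AE x in ?U. D x \<in> G1"
      using AE_not_in[OF B] by (auto simp: AE_restrict_space_iff G1_def VD elim!: eventually_mono)
    then have "AE \<omega> in distr ?U coins D. \<omega> \<in> G1"
      by (subst AE_distr_iff) auto
    then show ?thesis
      unfolding distr_D .
  qed

  \<comment> \<open>All integer powers of \<open>p\<close>: countably many, so that requiring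
    \<open>G1\<close> along all of them costs only a null set, and closed under composition with
    \<open>p\<close> and \<open>inv p\<close>.\<close>
  define Q where "Q = range (\<lambda>n. p ^^ n) \<union> range (\<lambda>n. inv p ^^ n)"
  have bij_inv: "bij (inv p)" using p by (rule bij_imp_bij_inv)
  have Q: "countable Q" "id \<in> Q" "\<And>q. q \<in> Q \<Longrightarrow> bij q"
    using p bij_inv by (auto simp: Q_def image_iff intro!: bij_fn exI[of _ 0])
  have Q_p: "p \<circ> q \<in> Q" "inv p \<circ> q \<in> Q" if "q \<in> Q" for q
  proof -
    have 1: "p \<circ> inv p ^^ Suc n = inv p ^^ n" "inv p \<circ> p ^^ Suc n = p ^^ n" for n
      using p by (auto simp: fun_eq_iff bij_is_surj surj_f_inv_f bij_is_inj)
    have 2: "p ^^ n \<in> Q" "inv p ^^ n \<in> Q" "p \<circ> p ^^ n \<in> Q" "inv p \<circ> inv p ^^ n \<in> Q" for n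
      by (auto simp: Q_def simp flip: funpow.simps(2))
    have 3: "p \<circ> inv p ^^ n \<in> Q" "inv p \<circ> p ^^ n \<in> Q" for n
      using 1 2 2[of 0] by (cases n; simp)+
    consider n where "q = p ^^ n" | n where "q = inv p ^^ n"
      using \<open>q \<in> Q\<close> unfolding Q_def by blast
    then show "p \<circ> q \<in> Q" "inv p \<circ> q \<in> Q"
      using 2 3 by (cases; blast)+
  qed
  have shift_meas [measurable]: "(\<lambda>\<omega>. \<omega> \<circ> q) \<in> coins \<rightarrow>\<^sub>M coins" for q :: "'i \<Rightarrow> 'i"
    by (intro measurable_to_coins) (auto simp: comp_def)
  have shift_distr: "distr coins coins (\<lambda>\<omega>. \<omega> \<circ> q) = (coins :: ('i \<Rightarrow> bool) measure)" if "bij q" for q :: "'i \<Rightarrow> 'i"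
    using distr_coins_reindex[OF that] by (simp add: comp_def)

  define G where "G = (\<Inter>q\<in>Q. {\<omega>. \<omega> \<circ> q \<in> G1})"
  have G [measurable]: "G \<in> sets coins"
    unfolding G_def
  proof (rule sets.countable_INT'[OF Q(1)])
    show "Q \<noteq> {}" using Q by auto
    show "(\<lambda>q. {\<omega>. \<omega> \<circ> q \<in> G1}) ` Q \<subseteq> sets coins"
      using measurable_sets[OF shift_meas G1] by (auto simp: vimage_def)
  qed
  have "G \<subseteq> G1"
  proof
    fix \<omega> assume "\<omega> \<in> G"
    then have "\<omega> \<circ> id \<in> G1"
      using Q(2) unfolding G_def by blast
    then show "\<omega> \<in> G1" by simp
  qed
  have G_shift: "\<omega> \<circ> p \<in> G" "\<omega> \<circ> inv p \<in> G" if "\<omega> \<in> G" for \<omega>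
    using that Q_p by (auto simp: G_def comp_assoc)
  have AE_G: "AE \<omega> in coins. \<omega> \<in> G"
  proof -
    have "AE \<omega> in coins. \<omega> \<circ> q \<in> G1" if "q \<in> Q" for q
    proof -
      have "AE \<omega> in distr coins coins (\<lambda>\<omega>. \<omega> \<circ> q). \<omega> \<in> G1"
        unfolding shift_distr[OF Q(3)[OF that]] by (rule AE_G1)
      then show ?thesis
        by (subst (asm) AE_distr_iff) auto
    qed
    then show ?thesis
      using Q(1) by (simp add: G_def AE_ball_countable)
  qed
  have emeasure_G: "emeasure coins (E \<inter> G) = emeasure coins E" if "E \<in> sets coins" for E
    using AE_G that by (intro emeasure_eq_AE) auto

  define Good where "Good = {x \<in> space M - A. \<phi> x \<in> {0..<1} \<and> D (\<phi> x) \<in> G}"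
  define \<psi> where "\<psi> x = D (\<phi> x)" for x
  have vimage_\<psi>: "\<psi> -` E \<inter> Good = \<phi> -` {x \<in> {0..<1}. D x \<in> E \<inter> G} \<inter> (space M - A)" for E
    by (auto simp: Good_def \<psi>_def)
  have pres\<psi>: "\<psi> -` E \<inter> Good \<in> sets M \<and> emeasure M (\<psi> -` E \<inter> Good) = emeasure coins E"
    if [measurable]: "E \<in> sets coins" for E
  proof -
    have 1: "{x \<in> {0..<1}. D x \<in> E \<inter> G} \<in> sets borel"
      by measurable
    have "x \<notin> B" if "x \<in> {0..<1}" "D x \<in> G" for x
      using that(2) \<open>G \<subseteq> G1\<close> VD[OF that(1)] unfolding G1_def by auto
    then have 2: "{x \<in> {0..<1}. D x \<in> E \<inter> G} \<subseteq> {0..1} - B"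
      by auto
    have "emeasure coins E = emeasure lborel {x \<in> {0..<1}. D x \<in> E \<inter> G}"
      using emeasure_coins[OF sets.Int[OF that G]] emeasure_G[OF that] by (simp only:)
    with pres[OF 1 2] show ?thesis
      unfolding vimage_\<psi> by (simp only:)
  qed
  have Good [measurable]: "Good \<in> sets M" and em_Good: "emeasure M Good = 1"
    using pres\<psi>[OF sets.top] by (simp_all add: coins.emeasure_space_1[simplified])
  have em_Bad: "emeasure M (space M - Good) = 0"
    using Good em_Good by (simp add: emeasure_compl emeasure_space_1)
  have bij\<psi>: "bij_betw \<psi> Good G"
    unfolding bij_betw_def
  proof
    show "inj_on \<psi> Good"
    proof (rule inj_onI)
      fix x y assume *: "x \<in> Good" "y \<in> Good" "\<psi> x = \<psi> y"
      then have "V (D (\<phi> x)) = V (D (\<phi> y))"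
        by (simp add: \<psi>_def)
      then have "\<phi> x = \<phi> y"
        using * by (simp add: Good_def VD)
      then show "x = y"
        using * \<phi>(2) by (auto simp: Good_def inj_on_def)
    qed
    show "\<psi> ` Good = G"
    proof
      show "G \<subseteq> \<psi> ` Good"
      proof
        fix \<omega> assume "\<omega> \<in> G"
        then have *: "V \<omega> \<in> {0..<1}" "V \<omega> \<notin> B" "D (V \<omega>) = \<omega>"
          using \<open>G \<subseteq> G1\<close> G1_D[of \<omega>] by (auto simp: G1_def)
        then have "V \<omega> \<in> \<phi> ` (space M - A)"
          using \<phi>(3) by auto
        then obtain x where "x \<in> space M - A" "\<phi> x = V \<omega>"
          by auto
        then show "\<omega> \<in> \<psi> ` Good"
          using * \<open>\<omega> \<in> G\<close> by (intro image_eqI[of _ _ x]) (auto simp: Good_def \<psi>_def)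
      qed
    qed (auto simp: Good_def \<psi>_def)
  qed
  \<comment> \<open>The image of \<open>W\<close> under \<open>\<phi>\<close> is Lebesgue
    measurable, hence a Borel set \<open>S\<close> plus a part of a Borel null set
    \<open>N'\<close>. The preimages of \<open>S\<close> and of \<open>S \<union> N'\<close> under
    \<open>V\<close> are the two bounds.\<close>
  have approx: "\<exists>E\<in>sets coins. \<exists>F\<in>sets coins. emeasure coins E = emeasure coins F \<and>
      \<psi> -` E \<inter> Good \<subseteq> W \<and> W \<inter> Good \<subseteq> \<psi> -` F" if W: "W \<in> sets M" for W
  proof -
    have "\<phi> ` (W \<inter> (space M - A)) \<in> sets lebesgue"
      using W A by (intro image) auto
    then obtain S N N' where S: "\<phi> ` (W \<inter> (space M - A)) = S \<union> N" "N \<subseteq> N'" "N' \<in> null_sets lborel" "S \<in> sets lborel"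
      by (rule sets_completionE)
    then have [measurable]: "S \<in> sets borel" "N' \<in> sets borel"
      by auto
    have VN: "V -` N' \<in> sets coins" "V -` S \<in> sets coins"
      using measurable_sets[OF DV(2), of N'] measurable_sets[OF DV(2), of S] by auto
    have "emeasure coins (V -` N') = emeasure lborel {x \<in> {0..<1}. x \<in> N'}"
      using VN by (subst emeasure_coins) (auto simp: VD intro!: arg_cong[where f = "emeasure lborel"])
    also have "\<dots> \<le> emeasure lborel N'"
      by (intro emeasure_mono) auto
    finally have "V -` N' \<in> null_sets coins"
      using S(3) VN by (auto simp: null_sets_def)
    then have "emeasure coins (V -` S \<union> V -` N') = emeasure coins (V -` S)"
      using VN by (intro emeasure_Un_null_set)
    moreover have "\<psi> -` (V -` S) \<inter> Good \<subseteq> W"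
    proof
      fix x assume x: "x \<in> \<psi> -` (V -` S) \<inter> Good"
      then have "\<phi> x \<in> S" "x \<in> space M - A"
        by (auto simp: \<psi>_def Good_def VD)
      then obtain w where "w \<in> W \<inter> (space M - A)" "\<phi> x = \<phi> w"
        using S(1) by blast
      with \<open>x \<in> space M - A\<close> show "x \<in> W"
        using \<phi>(2) by (auto simp: inj_on_def)
    qed
    moreover have "W \<inter> Good \<subseteq> \<psi> -` (V -` S \<union> V -` N')"
    proof
      fix x assume x: "x \<in> W \<inter> Good"
      then have "V (\<psi> x) = \<phi> x" "\<phi> x \<in> \<phi> ` (W \<inter> (space M - A))"
        by (auto simp: \<psi>_def Good_def VD)
      then show "x \<in> \<psi> -` (V -` S \<union> V -` N')"
        using S(1,2) by auto
    qed
    ultimately show ?thesis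
      using VN by (intro bexI[of _ "V -` S"] bexI[of _ "V -` S \<union> V -` N'"]) auto
  qed

  \<comment> \<open>Treating a general \<open>q\<close> covers \<open>p\<close> and
    \<open>inv p\<close> at once; the map for \<open>inv p\<close> is the inverse of
    \<open>T\<close>.\<close>
  define R where "R q = (\<lambda>x. if x \<in> Good then inv_into Good \<psi> (\<psi> x \<circ> q) else x)" for q
  have R: "R q \<in> M \<rightarrow>\<^sub>M M" "distr M M (R q) = M" if "bij q" "(\<lambda>\<omega>. \<omega> \<circ> q) ` G \<subseteq> G" for q
    unfolding R_def
    using transported_map[OF \<open>complete_measure M\<close> \<open>prob_space M\<close> Good em_Bad bij\<psi> _ _ approx shift_meas shift_distr[OF that(1)] that(2)] pres\<psi>
    by auto
  have G_image: "(\<lambda>\<omega>. \<omega> \<circ> p) ` G \<subseteq> G" "(\<lambda>\<omega>. \<omega> \<circ> inv p) ` G \<subseteq> G"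
    using G_shift by auto
  have R_Good: "R q x \<in> Good \<and> \<psi> (R q x) = \<psi> x \<circ> q" if "x \<in> Good" "(\<lambda>\<omega>. \<omega> \<circ> q) ` G \<subseteq> G" for q x
  proof -
    have "\<psi> x \<circ> q \<in> \<psi> ` Good"
      using that bij\<psi> by (auto simp: bij_betw_def)
    then show ?thesis
      using that(1) by (auto simp: R_def inv_into_into f_inv_into_f)
  qed
  have R_R: "R q' (R q x) = x" if "q \<circ> q' = id" "(\<lambda>\<omega>. \<omega> \<circ> q) ` G \<subseteq> G" "(\<lambda>\<omega>. \<omega> \<circ> q') ` G \<subseteq> G" for q q' x
  proof (cases "x \<in> Good")
    case True
    then have "R q' (R q x) \<in> Good" "\<psi> (R q' (R q x)) = \<psi> x"
      using R_Good that by (auto simp: comp_assoc)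
    then show ?thesis
      using True bij\<psi> by (auto simp: bij_betw_def inj_on_def)
  qed (simp add: R_def)
  have pp: "p \<circ> inv p = id" "inv p \<circ> p = id"
    using p by (auto simp: bij_is_surj bij_is_inj surj_iff[symmetric])
  define T where "T = R p"
  have T: "T \<in> M \<rightarrow>\<^sub>M M" "distr M M T = M" and T': "R (inv p) \<in> M \<rightarrow>\<^sub>M M"
    using R p bij_inv G_image by (auto simp: T_def)
  have inv1: "R (inv p) (T x) = x" "T (R (inv p) x) = x" for x
    unfolding T_def using R_R pp G_image by blast+
  have bij_T: "bij_betw T (space M) (space M)"
    by (rule bij_betw_byWitness[of _ "R (inv p)"]) (use inv1 measurable_space[OF T(1)] measurable_space[OF T'] in auto)
  have "the_inv_into (space M) T \<in> M \<rightarrow>\<^sub>M M"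
  proof -
    have "the_inv_into (space M) T y = R (inv p) y" if "y \<in> space M" for y
      using the_inv_into_f_eq[of T "space M" "R (inv p) y" y] bij_T inv1 measurable_space[OF T' that]
      by (auto simp: bij_betw_def)
    then show ?thesis
      using T' by (subst measurable_cong) auto
  qed
  with T bij_T have "mp_automorphism M T"
    by (simp add: mp_automorphism_def)
  \<comment> \<open>Off the good set \<open>T\<close> is the identity, so \<open>\<beta>\<close> has to take a value fixed by the permutation there.\<close>
  define \<beta> where "\<beta> x = (if x \<in> Good then \<psi> x else (\<lambda>_. False))" for x
  have vimage_\<beta>: "\<beta> -` E \<inter> space M = (\<psi> -` E \<inter> Good) \<union> (if (\<lambda>_. False) \<in> E then space M - Good else {})" for E
    using sets.sets_into_space[OF Good] by (auto simp: \<beta>_def split: if_splits)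
  have null: "(if b then space M - Good else {}) \<in> null_sets M" for b
    using em_Bad Good by (auto simp: null_sets_def)
  have \<beta>: "\<beta> \<in> M \<rightarrow>\<^sub>M coins"
    using pres\<psi> Good by (intro measurableI) (auto simp: vimage_\<beta>)
  moreover have "distr M coins \<beta> = coins"
  proof (rule measure_eqI)
    fix E :: "('i \<Rightarrow> bool) set" assume "E \<in> sets (distr M coins \<beta>)"
    then have "E \<in> sets coins" by simp
    then show "emeasure (distr M coins \<beta>) E = emeasure coins E"
      using pres\<psi> null by (simp add: emeasure_distr[OF \<beta>] vimage_\<beta> emeasure_Un_null_set del: if_split)
  qed simp
  moreover have "\<beta> (T x) = \<beta> x \<circ> p" if "x \<in> space M" for x
    using R_Good[of x p] G_image by (cases "x \<in> Good") (auto simp: \<beta>_def T_def R_def comp_def)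
  ultimately show thesis
    using \<open>mp_automorphism M T\<close> that by blast
qed

section \<open>Generated \<open>\<sigma>\<close>-algebras\<close>

text \<open>The sets that do not separate the two points are closed under complements and countable
  unions. This reduces questions about past and future events to pointwise comparisons of the
  process.\<close>

lemma generated_sigma_determined:
  assumes "A \<in> sets (generated_sigma M X J)" "x \<in> space M" "y \<in> space M" "\<And>j. j \<in> J \<Longrightarrow> X j x = X j y"
  shows "x \<in> A \<longleftrightarrow> y \<in> A"
proof -
  have "A \<in> sigma_sets (space M) (\<Union>j\<in>J. {X j -` B \<inter> space M |B. B \<in> sets borel})"
    using assms(1) unfolding generated_sigma_def by (subst (asm) sets_measure_of) auto
  then show ?thesis
    by induction (use assms(2-) in auto)
qed

lemma sets_generated_sigma_subset:
  assumes "\<And>j. j \<in> J \<Longrightarrow> X j \<in> borel_measurable M"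
  shows "sets (generated_sigma M X J) \<subseteq> sets M"
proof -
  have "(\<Union>j\<in>J. {X j -` B \<inter> space M |B. B \<in> sets borel}) \<subseteq> sets M"
    using assms by (auto intro: measurable_sets)
  then show ?thesis
    unfolding generated_sigma_def by (subst sets_measure_of) (auto dest: sets.sets_into_space intro: sets.sigma_sets_subset[THEN subsetD])
qed

text \<open>Preimages commute with the operations of a \<open>\<sigma>\<close>-algebra. Estimates
  for the process on \<open>M\<close> can therefore be proved on the coin space.\<close>

lemma generated_sigma_pullback:
  assumes "\<beta> \<in> space M \<rightarrow> space N" "\<And>j x. x \<in> space M \<Longrightarrow> X j x = Y j (\<beta> x)"
    and "A \<in> sets (generated_sigma M X J)"
  shows "\<exists>A'\<in>sets (generated_sigma N Y J). A = \<beta> -` A' \<inter> space M"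
proof -
  have sets_N: "sets (generated_sigma N Y J) = sigma_sets (space N) (\<Union>j\<in>J. {Y j -` B \<inter> space N |B. B \<in> sets borel})"
    unfolding generated_sigma_def by (subst sets_measure_of) auto
  have "A \<in> sigma_sets (space M) (\<Union>j\<in>J. {X j -` B \<inter> space M |B. B \<in> sets borel})"
    using assms(3) unfolding generated_sigma_def by (subst (asm) sets_measure_of) auto
  then show ?thesis
    unfolding sets_N
  proof induction
    case (Basic a)
    then obtain j B where "j \<in> J" "B \<in> sets borel" "a = X j -` B \<inter> space M"
      by auto
    moreover from this have "a = \<beta> -` (Y j -` B \<inter> space N) \<inter> space M"
      using assms(1,2) by auto
    ultimately show ?case
      by (intro bexI[of _ "Y j -` B \<inter> space N"]) (auto intro: sigma_sets.Basic)
  next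
    case Empty
    show ?case by (intro bexI[of _ "{}"]) (auto intro: sigma_sets.Empty)
  next
    case (Compl a)
    then obtain A' where "A' \<in> sigma_sets (space N) (\<Union>j\<in>J. {Y j -` B \<inter> space N |B. B \<in> sets borel})" "a = \<beta> -` A' \<inter> space M"
      by auto
    then show ?case
      using assms(1) by (intro bexI[of _ "space N - A'"]) (auto intro: sigma_sets.Compl)
  next
    case (Union a)
    let ?S = "sigma_sets (space N) (\<Union>j\<in>J. {Y j -` B \<inter> space N |B. B \<in> sets borel})"
    have "\<forall>i. \<exists>A'. A' \<in> ?S \<and> a i = \<beta> -` A' \<inter> space M"
      using Union.IH by blast
    from choice[OF this] obtain A' where "\<forall>i. A' i \<in> ?S \<and> a i = \<beta> -` A' i \<inter> space M"
      by blast
    then show ?case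
      by (intro bexI[of _ "\<Union>i. A' i"] sigma_sets.Union) auto
  qed
qed

section \<open>The queueing process\<close>

definition arrival :: "nat \<Rightarrow> int \<Rightarrow> (int \<times> nat \<Rightarrow> bool) set" where
  "arrival q j = {\<omega>. \<forall>i\<in>{1..q}. \<omega> (j, i)}"

lemma arrival_cylinder: "arrival q j = cylinder ({j} \<times> {1..q}) (\<lambda>_. True)"
  by (auto simp: arrival_def cylinder_def)

lemma sets_arrival [measurable]: "arrival q j \<in> sets coins"
  unfolding arrival_cylinder by (intro sets_cylinder) auto

lemma measure_arrival: "measure coins (arrival q j) = (1/2) ^ q"
  unfolding arrival_cylinder by (subst measure_coins_cylinder) (auto simp: card_cartesian_product)

lemma measure_arrival_Int:
  "j \<noteq> k \<Longrightarrow> measure coins (arrival q j \<inter> arrival q k) = (1/2) ^ q * (1/2) ^ q"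
proof -
  assume "j \<noteq> k"
  have "arrival q j \<inter> arrival q k = cylinder ({j, k} \<times> {1..q}) (\<lambda>_. True)"
    by (auto simp: arrival_def cylinder_def)
  then show ?thesis
    using \<open>j \<noteq> k\<close> by (simp add: measure_coins_cylinder card_cartesian_product power_add mult_2)
qed

text \<open>A Bonferroni bound: by pairwise independence, adding the next event to \<open>n\<close>
  earlier ones loses at most \<open>n * p ^ 2\<close> to overlaps.\<close>

lemma measure_UN_arrival_ge:
  "measure coins (\<Union>i<n. arrival q (- int i)) \<ge> n * (1/2) ^ q - (n * (1/2) ^ q)\<^sup>2"
proof -
  define p :: real where "p = (1/2) ^ q"
  have p: "0 \<le> p" by (simp add: p_def)
  have "measure coins (\<Union>i<n. arrival q (- int i)) \<ge> n * p - n ^ 2 * p ^ 2"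
  proof (induction n)
    case (Suc n)
    let ?U = "\<Union>i<n. arrival q (- int i)" and ?A = "arrival q (- int n)"
    have "measure coins (?U \<inter> ?A) \<le> (\<Sum>i<n. measure coins (arrival q (- int i) \<inter> ?A))"
      unfolding UN_extend_simps(4) by (intro coins.finite_measure_subadditive_finite) auto
    also have "\<dots> = n * p ^ 2"
      by (simp add: measure_arrival_Int p_def power2_eq_square)
    finally have "measure coins (?U \<inter> ?A) \<le> n * p ^ 2" .
    moreover have "measure coins (?U \<union> ?A) = measure coins ?U + measure coins ?A - measure coins (?U \<inter> ?A)"
      by (intro measure_Un3) (auto simp: coins.fmeasurable_eq_sets)
    ultimately have "measure coins (?U \<union> ?A) \<ge> (n * p - n ^ 2 * p ^ 2) + p - n * p ^ 2"
      using Suc by (simp add: measure_arrival p_def)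
    moreover have "?U \<union> ?A = (\<Union>i<Suc n. arrival q (- int i))"
      by (auto simp: lessThan_Suc)
    moreover have "(n * p - n ^ 2 * p ^ 2) + p - n * p ^ 2 \<ge> Suc n * p - (Suc n) ^ 2 * p ^ 2"
    proof -
      have "(real n + 1) * p ^ 2 \<ge> 0" using p by auto
      then show ?thesis by (simp add: algebra_simps power2_eq_square)
    qed
    ultimately show ?case
      by simp
  qed simp
  then show ?thesis
    by (simp add: p_def power_mult_distrib)
qed

text \<open>A discrete-time queue with infinitely many servers. The bits \<open>(j, i)\<close> belong to time \<open>j\<close>: a
  customer of kind \<open>\<kappa>\<close> arrives when the bits \<open>(j, 1), \<dots>, (j, q \<kappa>)\<close> are all set, and stays for
  \<open>N \<kappa>\<close> time units; bit \<open>(j, 0)\<close> is the fair sign which is put out when the system is empty.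
  Here \<open>busy s t\<close> says that somebody who came up to time \<open>s\<close> is still present at time \<open>t\<close>.\<close>

locale infinite_server =
  fixes q N :: "nat \<Rightarrow> nat"
  assumes q_pos: "q \<kappa> \<ge> 1"
    and load: "real (N \<kappa>) * (1/2) ^ q \<kappa> \<le> (1/2) ^ (\<kappa> + 2)"
begin

definition busy :: "int \<Rightarrow> int \<Rightarrow> (int \<times> nat \<Rightarrow> bool) set" where
  "busy s t = {\<omega>. \<exists>\<kappa> j. j \<le> s \<and> t < j + int (N \<kappa>) \<and> \<omega> \<in> arrival (q \<kappa>) j}"

definition Y :: "int \<Rightarrow> (int \<times> nat \<Rightarrow> bool) \<Rightarrow> real" where
  "Y t \<omega> = (if \<omega> \<in> busy t t then 0 else if \<omega> (t, 0) then 1 else - 1)"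

lemma busy_UN: "busy s t = (\<Union>\<kappa>. \<Union>j\<in>{t - int (N \<kappa>)<..s}. arrival (q \<kappa>) j)"
  by (force simp: busy_def)

lemma sets_busy [measurable]: "busy s t \<in> sets coins"
  unfolding busy_UN by (intro sets.countable_UN'' sets.finite_UN) auto

lemma Y_measurable [measurable]: "Y t \<in> borel_measurable coins"
  unfolding Y_def by measurable

lemma Y_range: "Y t \<omega> \<in> {-1, 0, 1}"
  by (simp add: Y_def)

text \<open>The total load bound of the kinds that stay longer than \<open>n\<close>; the others
  have left \<open>n\<close> time units after their arrival.\<close>

definition overhang :: "nat \<Rightarrow> real" where
  "overhang n = (\<Sum>\<kappa>. if n < N \<kappa> then (1/2) ^ (\<kappa> + 2) else 0)"

lemma summable_load: "summable (\<lambda>\<kappa>. (1/2 :: real) ^ (\<kappa> + 2))"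
  by (simp add: summable_mult2 power_add)

lemma summable_overhang: "summable (\<lambda>\<kappa>. if n < N \<kappa> then (1/2 :: real) ^ (\<kappa> + 2) else 0)"
  by (rule summable_comparison_test'[OF summable_load, of 0]) auto

text \<open>Union bound: a customer of kind \<open>\<kappa>\<close> who is still present must have
  come during the last \<open>N \<kappa> - n\<close> time units up to \<open>s\<close>.\<close>

lemma measure_busy_le: "measure coins (busy s (s + int n)) \<le> overhang n"
proof -
  let ?B = "\<lambda>\<kappa>. \<Union>j\<in>{s + int n - int (N \<kappa>)<..s}. arrival (q \<kappa>) j"
  have *: "measure coins (?B \<kappa>) \<le> (if n < N \<kappa> then (1/2) ^ (\<kappa> + 2) else 0)" for \<kappa>
  proof (cases "n < N \<kappa>")
    case True
    have "measure coins (?B \<kappa>) \<le> (\<Sum>j\<in>{s + int n - int (N \<kappa>)<..s}. measure coins (arrival (q \<kappa>) j))"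
      by (intro coins.finite_measure_subadditive_finite) auto
    also have "\<dots> = real (N \<kappa> - n) * (1/2) ^ q \<kappa>"
      using True by (simp add: measure_arrival nat_diff_distrib)
    also have "\<dots> \<le> real (N \<kappa>) * (1/2) ^ q \<kappa>"
      by (intro mult_right_mono) auto
    finally show ?thesis
      using load[of \<kappa>] True by simp
  qed simp
  have sum: "summable (\<lambda>\<kappa>. measure coins (?B \<kappa>))"
    by (rule summable_comparison_test'[OF summable_overhang[of n], of 0]) (use * in auto)
  have "measure coins (busy s (s + int n)) \<le> (\<Sum>\<kappa>. measure coins (?B \<kappa>))"
    unfolding busy_UN using sum by (intro coins.finite_measure_subadditive_countably) auto
  also have "\<dots> \<le> overhang n"
    unfolding overhang_def by (intro suminf_le * sum summable_overhang)
  finally show ?thesis .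
qed

text \<open>The load bounds add up to 1/2. With \<open>n = 0\<close> this leaves the queue empty,
  and the process nonzero, with probability at least 1/2.\<close>

lemma overhang_le: "overhang n \<le> 1/2"
proof -
  have "(\<lambda>\<kappa>. (1/2 :: real) ^ \<kappa> * (1/4)) sums (1 / (1 - 1/2) * (1/4))"
    by (intro sums_mult2 geometric_sums) auto
  then have s: "(\<lambda>\<kappa>. (1/2 :: real) ^ (\<kappa> + 2)) sums (1/2)"
    by (simp add: power_add power2_eq_square)
  have "overhang n \<le> (\<Sum>\<kappa>. (1/2) ^ (\<kappa> + 2))"
    unfolding overhang_def by (intro suminf_le summable_overhang summable_load) auto
  then show ?thesis
    using s by (simp add: sums_iff)
qed

text \<open>Dominated convergence for series: the term of \<open>\<kappa>\<close> vanishes once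
  \<open>n\<close> reaches \<open>N \<kappa>\<close>.\<close>

lemma overhang_tendsto: "overhang \<longlonglongrightarrow> 0"
proof -
  have "(\<lambda>n. \<Sum>\<kappa>. if n < N \<kappa> then (1/2 :: real) ^ (\<kappa> + 2) else 0) \<longlonglongrightarrow> (\<Sum>\<kappa>. 0)"
  proof (rule tannerys_theorem[THEN conjunct2, THEN conjunct2])
    show "(\<lambda>n. if n < N \<kappa> then (1/2 :: real) ^ (\<kappa> + 2) else 0) \<longlonglongrightarrow> 0" for \<kappa>
      by (rule tendsto_eventually) (auto simp: eventually_sequentially intro!: exI[of _ "N \<kappa>"])
    show "\<forall>\<^sub>F (\<kappa>, n) in at_top \<times>\<^sub>F sequentially. norm (if n < N \<kappa> then (1/2 :: real) ^ (\<kappa> + 2) else 0) \<le> (1/2) ^ (\<kappa> + 2)"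
      by (intro always_eventually) auto
  qed (use summable_load in auto)
  then show ?thesis
    by (simp add: overhang_def[abs_def])
qed

section \<open>Stationarity, strong mixing and the martingale property\<close>

lemma Y_shift: "Y t (\<lambda>(j, i). \<omega> (j + 1, i)) = Y (t + 1) \<omega>"
proof -
  have 1: "(\<lambda>(j, i). \<omega> (j + 1, i)) \<in> arrival a j \<longleftrightarrow> \<omega> \<in> arrival a (j + 1)" for a j
    by (simp add: arrival_def)
  have "(\<lambda>(j, i). \<omega> (j + 1, i)) \<in> busy t t \<longleftrightarrow> \<omega> \<in> busy (t + 1) (t + 1)"
  proof
    assume "(\<lambda>(j, i). \<omega> (j + 1, i)) \<in> busy t t"
    then obtain \<kappa> j where "j \<le> t" "t < j + int (N \<kappa>)" "\<omega> \<in> arrival (q \<kappa>) (j + 1)"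
      by (auto simp: busy_def 1)
    then show "\<omega> \<in> busy (t + 1) (t + 1)"
      by (auto simp: busy_def intro!: exI[of _ \<kappa>] exI[of _ "j + 1"])
  next
    assume "\<omega> \<in> busy (t + 1) (t + 1)"
    then obtain \<kappa> j where "j \<le> t + 1" "t + 1 < j + int (N \<kappa>)" "\<omega> \<in> arrival (q \<kappa>) j"
      by (auto simp: busy_def)
    then show "(\<lambda>(j, i). \<omega> (j + 1, i)) \<in> busy t t"
      by (auto simp: busy_def 1 intro!: exI[of _ \<kappa>] exI[of _ "j - 1"])
  qed
  then show ?thesis
    by (simp add: Y_def)
qed

lemma arrival_cong: "(\<And>i. \<omega> (j, i) = \<omega>' (j, i)) \<Longrightarrow> \<omega> \<in> arrival a j \<longleftrightarrow> \<omega>' \<in> arrival a j"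
  by (simp add: arrival_def)

lemma Y_cong:
  assumes "\<And>j i. j \<le> t \<Longrightarrow> \<omega> (j, i) = \<omega>' (j, i)"
  shows "Y t \<omega> = Y t \<omega>'"
proof -
  have "\<omega> \<in> busy t t \<longleftrightarrow> \<omega>' \<in> busy t t"
    unfolding busy_def using arrival_cong[of \<omega> _ \<omega>'] assms by blast
  then show ?thesis
    using assms[of t 0] by (simp add: Y_def)
qed

text \<open>Clearing all bits up to time \<open>k\<close> only removes customers who have left by
  time \<open>k + n\<close>. Since \<open>n \<ge> 1\<close>, the sign bit of time \<open>t\<close>
  lies beyond the cut.\<close>

lemma Y_truncate:
  assumes "n \<ge> 1" "k + int n \<le> t" "\<omega> \<notin> busy k (k + int n)"
  shows "Y t (\<lambda>p. \<omega> p \<and> k < fst p) = Y t \<omega>"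
proof -
  let ?\<omega> = "\<lambda>p. \<omega> p \<and> k < fst p"
  have "?\<omega> \<in> busy t t \<longleftrightarrow> \<omega> \<in> busy t t"
  proof
    assume "?\<omega> \<in> busy t t"
    then show "\<omega> \<in> busy t t"
      by (fastforce simp: busy_def arrival_def)
  next
    assume "\<omega> \<in> busy t t"
    then obtain \<kappa> j where j: "j \<le> t" "t < j + int (N \<kappa>)" "\<omega> \<in> arrival (q \<kappa>) j"
      by (auto simp: busy_def)
    have "k < j"
    proof (rule ccontr)
      assume "\<not> k < j"
      then have "j \<le> k" "k + int n < j + int (N \<kappa>)"
        using j assms(2) by auto
      then show False
        using j(3) assms(3) unfolding busy_def by blast
    qed
    then have "?\<omega> \<in> arrival (q \<kappa>) j"
      using j by (auto simp: arrival_def)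
    then show "?\<omega> \<in> busy t t"
      using j unfolding busy_def by blast
  qed
  then show ?thesis
    using assms by (simp add: Y_def)
qed

text \<open>Evaluating \<open>V\<close> on the truncated bits gives \<open>V'\<close>, which depends
  only on bits after time \<open>k\<close> and is thus independent of \<open>U\<close>. It differs
  from \<open>V\<close> only inside \<open>B\<close>, and replacing \<open>V\<close> in both terms
  costs \<open>overhang n\<close> twice.\<close>

lemma mixing_bound:
  assumes U: "U \<in> sets (generated_sigma coins (\<lambda>k. Y (int k)) {j. j \<le> k})"
    and V: "V \<in> sets (generated_sigma coins (\<lambda>k. Y (int k)) {j. k + n \<le> j})"
    and "n \<ge> 1"
  shows "\<bar>measure coins (U \<inter> V) - measure coins U * measure coins V\<bar> \<le> 2 * overhang n"
proof -
  let ?m = "\<lambda>\<omega> p. \<omega> p \<and> int k < fst p"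
  define V' where "V' = {\<omega>. ?m \<omega> \<in> V}"
  define B where "B = busy (int k) (int k + int n)"
  have [measurable]: "U \<in> sets coins" "V \<in> sets coins" "B \<in> sets coins"
    using U V sets_generated_sigma_subset[of _ "\<lambda>k. Y (int k)" coins] by (auto simp: B_def)
  have "?m \<in> coins \<rightarrow>\<^sub>M coins"
    by (intro measurable_to_coins) measurable
  from measurable_sets[OF this, of V] have [measurable]: "V' \<in> sets coins"
    by (simp add: V'_def vimage_def)
  have eq: "\<omega> \<in> V \<longleftrightarrow> \<omega> \<in> V'" if "\<omega> \<notin> B" for \<omega>
    unfolding V'_def mem_Collect_eq using \<open>n \<ge> 1\<close> that
    by (intro generated_sigma_determined[OF V]) (auto simp: B_def Y_truncate)
  have "determined_by {p. fst p \<le> int k} U"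
    unfolding determined_by_def
  proof (intro allI impI)
    fix \<omega> \<omega>' :: "int \<times> nat \<Rightarrow> bool"
    assume *: "\<forall>p\<in>{p. fst p \<le> int k}. \<omega> p = \<omega>' p" and "\<omega> \<in> U"
    have "\<omega> \<in> U \<longleftrightarrow> \<omega>' \<in> U"
      by (rule generated_sigma_determined[OF U]) (use * in \<open>auto intro!: Y_cong\<close>)
    with \<open>\<omega> \<in> U\<close> show "\<omega>' \<in> U"
      by simp
  qed
  moreover have "determined_by (- {p. fst p \<le> int k}) V'"
    unfolding determined_by_def
  proof (intro allI impI)
    fix \<omega> \<omega>' :: "int \<times> nat \<Rightarrow> bool"
    assume *: "\<forall>p\<in>- {p. fst p \<le> int k}. \<omega> p = \<omega>' p" and "\<omega> \<in> V'"
    then have "?m \<omega> = ?m \<omega>'"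
      by (auto simp: fun_eq_iff)
    with \<open>\<omega> \<in> V'\<close> show "\<omega>' \<in> V'"
      unfolding V'_def mem_Collect_eq by simp
  qed
  ultimately have indep: "measure coins (U \<inter> V') = measure coins U * measure coins V'"
    by (intro coins_indep) auto
  have diff: "\<bar>measure coins E - measure coins F\<bar> \<le> overhang n"
    if [measurable]: "E \<in> sets coins" "F \<in> sets coins" and "E - B = F - B" for E F
  proof -
    have "measure coins E \<le> measure coins (F \<union> B)" "measure coins F \<le> measure coins (E \<union> B)"
      using that(3) by (intro coins.finite_measure_mono; force)+
    moreover have "measure coins (F \<union> B) \<le> measure coins F + measure coins B" "measure coins (E \<union> B) \<le> measure coins E + measure coins B"
      by (intro measure_Un_le; simp)+
    ultimately show ?thesis
      using measure_busy_le[of "int k" n] by (simp add: B_def)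
  qed
  have "\<bar>measure coins (U \<inter> V) - measure coins (U \<inter> V')\<bar> \<le> overhang n"
    using eq by (intro diff) auto
  moreover have 2: "\<bar>measure coins V' - measure coins V\<bar> \<le> overhang n"
    using eq by (intro diff) auto
  moreover have "\<bar>measure coins U * (measure coins V' - measure coins V)\<bar> \<le> 1 * overhang n"
    unfolding abs_mult using 2 by (intro mult_mono) auto
  ultimately show ?thesis
    using indep by (simp add: algebra_simps)
qed

text \<open>Flipping the sign bit of time \<open>k\<close> preserves the measure, all arrivals and
  the past event \<open>A\<close>, but negates the integrand. The integral thus equals its own
  negative.\<close>

lemma Y_martingale_difference:
  assumes A: "A \<in> sets (generated_sigma coins (\<lambda>k. Y (int k)) {j. j < k})"
  shows "(\<integral>\<omega>\<in>A. Y (int k) \<omega> \<partial>coins) = 0"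
proof -
  let ?\<theta> = "\<lambda>\<omega>. fun_upd \<omega> (int k, 0) (\<not> \<omega> (int k, 0 :: nat))"
  have \<theta>: "?\<theta> \<in> coins \<rightarrow>\<^sub>M coins"
    by (intro measurable_to_coins) (auto simp: fun_upd_def)
  have [measurable]: "A \<in> sets coins"
    using A sets_generated_sigma_subset[of _ "\<lambda>k. Y (int k)" coins] by auto
  have "?\<theta> \<omega> \<in> arrival a j \<longleftrightarrow> \<omega> \<in> arrival a j" for \<omega> a j
    by (auto simp: arrival_def)
  then have busy: "?\<theta> \<omega> \<in> busy s t \<longleftrightarrow> \<omega> \<in> busy s t" for \<omega> s t
    unfolding busy_def mem_Collect_eq by simp
  have Y: "Y (int k) (?\<theta> \<omega>) = - Y (int k) \<omega>" for \<omega>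
    unfolding Y_def busy by simp
  have A: "?\<theta> \<omega> \<in> A \<longleftrightarrow> \<omega> \<in> A" for \<omega>
    by (rule generated_sigma_determined[OF A]) (auto simp: Y_def busy)
  have "(\<integral>\<omega>\<in>A. Y (int k) \<omega> \<partial>coins) = (\<integral>\<omega>. indicator A \<omega> * Y (int k) \<omega> \<partial>distr coins coins ?\<theta>)"
    by (simp add: set_lebesgue_integral_def distr_coins_flip)
  also have "\<dots> = (\<integral>\<omega>. indicator A (?\<theta> \<omega>) * Y (int k) (?\<theta> \<omega>) \<partial>coins)"
    by (subst integral_distr[OF \<theta>]) auto
  also have "\<dots> = (\<integral>\<omega>. - (indicator A \<omega> * Y (int k) \<omega>) \<partial>coins)"
    by (intro Bochner_Integration.integral_cong refl) (simp only: Y indicator_def A)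
  also have "\<dots> = - (\<integral>\<omega>\<in>A. Y (int k) \<omega> \<partial>coins)"
    by (simp add: set_lebesgue_integral_def)
  finally show ?thesis by simp
qed

text \<open>A customer who came at one of the times \<open>0, -1, ..., -(n - 1)\<close> and stays
  \<open>2 * n\<close> units is present throughout \<open>0, ..., n - 1\<close>.\<close>

lemma measure_zero_run:
  assumes "N \<kappa> = 2 * n"
  shows "measure coins {\<omega>. \<forall>k<n. Y (int k) \<omega> = 0} \<ge> n * (1/2) ^ q \<kappa> - (n * (1/2) ^ q \<kappa>)\<^sup>2"
proof -
  have "(\<Union>i<n. arrival (q \<kappa>) (- int i)) \<subseteq> {\<omega>. \<forall>k<n. Y (int k) \<omega> = 0}"
  proof safe
    fix \<omega> i k assume "\<omega> \<in> arrival (q \<kappa>) (- int i)" "i < n" "k < n"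
    then have "\<omega> \<in> busy (int k) (int k)"
      unfolding busy_def using assms by (auto intro!: exI[of _ \<kappa>] exI[of _ "- int i"])
    then show "Y (int k) \<omega> = 0"
      by (simp add: Y_def)
  qed
  moreover have "Measurable.pred coins (\<lambda>\<omega>. \<forall>k<n. Y (int k) \<omega> = 0)"
    by measurable
  then have "{\<omega>. \<forall>k<n. Y (int k) \<omega> = 0} \<in> sets coins"
    by (simp add: pred_def)
  ultimately have "measure coins (\<Union>i<n. arrival (q \<kappa>) (- int i)) \<le> measure coins {\<omega>. \<forall>k<n. Y (int k) \<omega> = 0}"
    by (intro coins.finite_measure_mono)
  with measure_UN_arrival_ge[of n "q \<kappa>"] show ?thesis
    by linarith
qed

lemma measure_Y_zero_le: "measure coins {\<omega>. Y t \<omega> = 0} \<le> 1/2"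
proof -
  have "{\<omega>. Y t \<omega> = 0} = busy t (t + int 0)"
    by (auto simp: Y_def)
  then show ?thesis
    using measure_busy_le[of t 0] overhang_le[of 0] by simp
qed

end

section \<open>Jumps and the normal distribution function\<close>

text \<open>With \<open>s\<close> the supremum, the jump is at most
  \<open>2 * s + \<Phi> y - \<Phi> x\<close> for every \<open>x < y\<close>; let \<open>x\<close>
  tend to \<open>y\<close>.\<close>

lemma SUP_dist_continuous_cdf_ge_jump:
  fixes F \<Phi> :: "real \<Rightarrow> real"
  assumes F: "\<And>x. 0 \<le> F x" "\<And>x. F x \<le> 1" and \<Phi>: "\<And>x. 0 \<le> \<Phi> x" "\<And>x. \<Phi> x \<le> 1" "isCont \<Phi> y"
    and jump: "\<And>x. x < y \<Longrightarrow> F x + p \<le> F y"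
  shows "p / 2 \<le> (SUP x. \<bar>F x - \<Phi> x\<bar>)"
proof -
  define s where "s = (SUP x. \<bar>F x - \<Phi> x\<bar>)"
  have "\<bar>F x - \<Phi> x\<bar> \<le> 1" for x
    using F[of x] \<Phi>(1,2)[of x] by (simp add: abs_le_iff)
  then have bdd: "bdd_above (range (\<lambda>x. \<bar>F x - \<Phi> x\<bar>))"
    by (intro bdd_aboveI[of _ 1]) auto
  have le: "\<bar>F x - \<Phi> x\<bar> \<le> s" for x
    unfolding s_def by (intro cSUP_upper bdd) simp
  have "((\<lambda>x. 2 * s + \<Phi> y - \<Phi> x) \<longlongrightarrow> 2 * s + \<Phi> y - \<Phi> y) (at_left y)"
    using \<Phi>(3) by (intro tendsto_intros) (auto simp: isCont_def intro: tendsto_within_subset)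
  moreover have "\<forall>\<^sub>F x in at_left y. p \<le> 2 * s + \<Phi> y - \<Phi> x"
  proof -
    have "p \<le> 2 * s + \<Phi> y - \<Phi> x" if "x < y" for x
      using jump[OF that] le[of x] le[of y] by linarith
    then show ?thesis
      by (auto simp: eventually_at_filter)
  qed
  ultimately have "p \<le> 2 * s + \<Phi> y - \<Phi> y"
    by (rule tendsto_lowerbound) simp
  then show ?thesis
    by (simp add: s_def)
qed

lemma isCont_std_normal_cdf: "isCont (cdf std_normal_distribution) x"
proof -
  interpret real_distribution std_normal_distribution
    by (rule real_dist_normal_dist)
  have "emeasure std_normal_distribution {x} = (\<integral>\<^sup>+y. ennreal (std_normal_density y) * indicator {x} y \<partial>lborel)"
    by (subst emeasure_density) auto
  also have "\<dots> = 0"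
    by (subst nn_integral_0_iff_AE) (auto intro!: AE_I[where N = "{x}"])
  finally show ?thesis
    by (simp add: isCont_cdf measure_def)
qed

text \<open>Powers of two are used because they cancel exactly against arrival probabilities, which
  are powers of 1/2.\<close>

lemma ex_strict_mono_dyadic_decay:
  fixes a \<epsilon> :: "nat \<Rightarrow> real"
  assumes "a \<longlonglongrightarrow> 0" "\<And>k. \<epsilon> k > 0"
  obtains m where "strict_mono m" "\<And>k. a (2 ^ m k) \<le> \<epsilon> k"
proof -
  have "(\<lambda>n. a (2 ^ n)) \<longlonglongrightarrow> 0"
    using filterlim_compose[OF assms(1), of "\<lambda>n. 2 ^ n" sequentially] filterlim_subseq[of "\<lambda>n. 2 ^ n :: nat"]
    by (simp add: strict_mono_def)
  then have "\<exists>M. \<forall>n\<ge>M. a (2 ^ n) < \<epsilon> k" for k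
    using assms(2)[of k] by (auto dest: order_tendstoD(2) simp: eventually_sequentially)
  then obtain M where M: "\<And>k n. n \<ge> M k \<Longrightarrow> a (2 ^ n) < \<epsilon> k"
    by metis
  \<comment> \<open>Partial sums of positive terms increase strictly and dominate each
    \<open>M k\<close>.\<close>
  define m where "m k = (\<Sum>i\<le>k. Suc (M i))" for k
  have "strict_mono m"
    by (simp add: strict_mono_Suc_iff m_def)
  moreover have "M k \<le> m k" for k
    using member_le_sum[of k "{..k}" "\<lambda>i. Suc (M i)"] by (simp add: m_def)
  then have "a (2 ^ m k) \<le> \<epsilon> k" for k
    using M less_imp_le by blast
  ultimately show thesis
    using that by blast
qed

section \<open>The construction\<close>

theorem theorem3:
  fixes M :: "'a measure" and a :: "nat \<Rightarrow> real"
  assumes "lebesgue_prob_space M" and "non_atomic M"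
    and "\<And>n. a n > 0" and "decseq a" and "a \<longlonglongrightarrow> 0"
  shows "\<exists>(T :: 'a \<Rightarrow> 'a) (f :: 'a \<Rightarrow> real).
    mp_automorphism M T \<and>
    f \<in> L_infinity M \<and> (\<forall>x\<in>space M. f x \<in> \<int>) \<and> nondegenerate_distr (distr M borel f) \<and>
    martingale_difference_seq M (\<lambda>k. f \<circ> (T ^^ k)) \<and>
    strongly_mixing M (\<lambda>k. f \<circ> (T ^^ k)) \<and>
    (\<forall>k. \<forall>x\<in>space M. (f \<circ> (T ^^ k)) x \<in> {-1, 0, 1}) \<and>
    (\<exists>n :: nat \<Rightarrow> nat. strict_mono n \<and> (\<forall>k. n k > 0) \<and>
      (\<forall>k. measure M {x \<in> space M. birkhoff_sum T f (n k) x = 0} \<ge> a (n k) \<and>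
        (SUP x. \<bar>normalized_cdf M T f (n k) x - cdf std_normal_distribution x\<bar>) \<ge> a (n k) / 2))"
proof -
  interpret M: prob_space M
    using assms(1) by (simp add: lebesgue_prob_space_def)
  obtain m where m: "strict_mono m" "\<And>k. a (2 ^ m k) \<le> (1/2) ^ (k + 4)"
    using ex_strict_mono_dyadic_decay[OF assms(5), of "\<lambda>k. (1/2) ^ (k + 4)"] by auto
  define n :: "nat \<Rightarrow> nat" where "n k = 2 ^ m k" for k
  define N where "N k = 2 * n k" for k
  \<comment> \<open>Chosen so that \<open>n k * (1/2) ^ q k\<close> is exactly
    \<open>(1/2) ^ (k + 3)\<close>. Doubling the stay then meets the load bound
    \<open>(1/2) ^ (k + 2)\<close>, and half of this value is the bound imposed on
    \<open>a (n k)\<close>.\<close>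
  define q where "q k = m k + k + 3" for k
  have np: "n k * (1/2) ^ q k = (1/2 :: real) ^ (k + 3)" for k
    by (simp add: n_def q_def power_add power_one_over)
  interpret infinite_server q N
  proof
    show "1 \<le> q k" for k
      by (simp add: q_def)
    show "real (N k) * (1/2) ^ q k \<le> (1/2) ^ (k + 2)" for k
    proof -
      have "(1/2 :: real) ^ (k + 2) = 2 * (1/2) ^ (k + 3)"
        by (simp add: eval_nat_numeral)
      then show ?thesis
        using np[of k] by (simp add: N_def)
    qed
  qed

  have "infinite (UNIV :: (int \<times> nat) set)"
    by (simp add: finite_prod)
  then obtain enc :: "int \<times> nat \<Rightarrow> nat" where enc: "bij enc"
    using countableE_infinite[of "UNIV :: (int \<times> nat) set"] by auto
  let ?p = "\<lambda>(j :: int, i :: nat). (j + 1, i)"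
  have "bij ?p"
    by (rule bij_betw_byWitness[of _ "\<lambda>(j, i). (j - 1, i)"]) auto
  from complete_lebesgue_prob_space_coding[OF assms(1,2) enc this]
  obtain T \<beta> where T: "mp_automorphism M T" and \<beta> [measurable]: "\<beta> \<in> M \<rightarrow>\<^sub>M coins"
    and \<beta>_distr: "distr M coins \<beta> = coins" and \<beta>_T: "\<And>x. x \<in> space M \<Longrightarrow> \<beta> (T x) = \<beta> x \<circ> ?p"
    by metis
  define f where "f x = Y 0 (\<beta> x)" for x
  have T_space: "T x \<in> space M" if "x \<in> space M" for x
    using T that by (auto simp: mp_automorphism_def bij_betw_def)
  \<comment> \<open>The time \<open>t\<close> is kept general because each application of
    \<open>T\<close> moves it on by one.\<close>
  have Y_T: "Y t (\<beta> ((T ^^ k) x)) = Y (t + int k) (\<beta> x) \<and> (T ^^ k) x \<in> space M" if "x \<in> space M" for x t k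
    using that
  proof (induction k arbitrary: t)
    case (Suc k)
    have "Y t (\<beta> (T ((T ^^ k) x))) = Y (t + 1) (\<beta> ((T ^^ k) x))"
      using Suc Y_shift[of t "\<beta> ((T ^^ k) x)"] by (simp add: \<beta>_T comp_def case_prod_unfold)
    then show ?case
      using Suc T_space by (simp add: add_ac)
  qed simp
  define X where "X k = f \<circ> (T ^^ k)" for k
  have X: "X k x = Y (int k) (\<beta> x)" if "x \<in> space M" for k x
    using Y_T[OF that, of 0 k] by (simp add: X_def f_def)
  have X_meas [measurable]: "X k \<in> borel_measurable M" for k
    by (subst measurable_cong[OF X]) auto
  have f_meas [measurable]: "f \<in> borel_measurable M"
    unfolding f_def by measurable
  have measure_\<beta>: "measure M (\<beta> -` E \<inter> space M) = measure coins E" if "E \<in> sets coins" for E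
    using measure_distr[OF \<beta> that] by (simp add: \<beta>_distr)
  have pullback: "\<exists>A'\<in>sets (generated_sigma coins (\<lambda>k. Y (int k)) J). A = \<beta> -` A' \<inter> space M"
    if "A \<in> sets (generated_sigma M X J)" for A J
    by (rule generated_sigma_pullback[OF _ _ that]) (auto simp: X)
  have gen_coins: "sets (generated_sigma coins (\<lambda>k. Y (int k)) J) \<subseteq> sets coins" for J
    by (rule sets_generated_sigma_subset) simp
  have X_int: "integrable M (X k)" for k
    by (rule M.integrable_const_bound[of _ 1]) (auto simp: X Y_def)

  \<comment> \<open>The martingale difference property on \<open>M\<close>\<close>
  have set_int: "(\<integral>x\<in>A. X k x \<partial>M) = 0" if A: "A \<in> sets (generated_sigma M X {j. j < k})" for A k
  proof -
    obtain A' where A': "A' \<in> sets (generated_sigma coins (\<lambda>k. Y (int k)) {j. j < k})" "A = \<beta> -` A' \<inter> space M"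
      using pullback[OF A] by auto
    then have [measurable]: "A' \<in> sets coins"
      using gen_coins by auto
    have "(\<integral>x\<in>A. X k x \<partial>M) = (\<integral>x. indicator A' (\<beta> x) * Y (int k) (\<beta> x) \<partial>M)"
      unfolding set_lebesgue_integral_def
      by (intro Bochner_Integration.integral_cong) (auto simp: A'(2) X split: split_indicator)
    also have "\<dots> = (\<integral>\<omega>. indicator A' \<omega> * Y (int k) \<omega> \<partial>distr M coins \<beta>)"
      by (subst integral_distr) auto
    also have "\<dots> = 0"
      using Y_martingale_difference[OF A'(1)] by (simp add: \<beta>_distr set_lebesgue_integral_def)
    finally show ?thesis .
  qed
  have mds: "martingale_difference_seq M X"
    unfolding martingale_difference_seq_def
  proof (intro allI conjI X_int)
    fix k
    let ?F = "generated_sigma M X {j. j < k}"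
    interpret finite_measure_subalgebra M ?F
      by unfold_locales
        (use sets_generated_sigma_subset[of "{j. j < k}" X M] in \<open>auto simp: subalgebra_def generated_sigma_def space_measure_of_conv\<close>)
    \<comment> \<open>Vanishing integrals over all past events identify 0 as a version of the
      conditional expectation.\<close>
    show "AE x in M. real_cond_exp M ?F (X k) x = 0"
      by (rule real_cond_exp_charact) (use set_int X_int in auto)
  qed

  \<comment> \<open>Strong mixing on \<open>M\<close>\<close>
  have alpha_le: "\<bar>measure M (U \<inter> V) - measure M U * measure M V\<bar> \<le> 2 * overhang j"
    if UVj: "U \<in> sets (generated_sigma M X {i. i \<le> k})" "V \<in> sets (generated_sigma M X {i. i \<ge> k + j})" "j \<ge> 1" for U V j k
  proof -
    obtain U' V' where UV: "U' \<in> sets (generated_sigma coins (\<lambda>k. Y (int k)) {i. i \<le> k})" "U = \<beta> -` U' \<inter> space M"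
        "V' \<in> sets (generated_sigma coins (\<lambda>k. Y (int k)) {i. i \<ge> k + j})" "V = \<beta> -` V' \<inter> space M"
      using pullback[OF UVj(1)] pullback[OF UVj(2)] by auto
    have sets: "U' \<in> sets coins" "V' \<in> sets coins"
      using UV gen_coins by auto
    have "U \<inter> V = \<beta> -` (U' \<inter> V') \<inter> space M"
      using UV by auto
    then have "measure M (U \<inter> V) = measure coins (U' \<inter> V')"
      using measure_\<beta>[OF sets.Int[OF sets]] by (simp only:)
    moreover have "measure M U = measure coins U'" "measure M V = measure coins V'"
      unfolding UV(2,4) by (rule measure_\<beta>, rule sets)+
    ultimately show ?thesis
      using mixing_bound[OF UV(1,3) UVj(3)] by (simp only:)
  qed
  have rate: "0 \<le> alpha_mixing_rate M X j \<and> alpha_mixing_rate M X j \<le> 2 * overhang j" if "j \<ge> 1" for j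
  proof -
    let ?S = "\<lambda>k. {\<bar>measure M (U \<inter> V) - measure M U * measure M V\<bar> |U V.
      U \<in> sets (generated_sigma M X {i. i \<le> k}) \<and> V \<in> sets (generated_sigma M X {i. i \<ge> k + j})}"
    \<comment> \<open>An empty \<open>U\<close> contributes 0, so the suprema are over nonempty sets
      and are nonnegative.\<close>
    have ne: "0 \<in> ?S k" for k
      by (intro CollectI exI[of _ "{}"]) auto
    have ub: "s \<le> 2 * overhang j" if "s \<in> ?S k" for s k
      using that alpha_le \<open>j \<ge> 1\<close> by auto
    let ?c = "\<lambda>k. alpha_coeff M (generated_sigma M X {i. i \<le> k}) (generated_sigma M X {i. i \<ge> k + j})"
    have c: "?c k \<le> 2 * overhang j" "0 \<le> ?c k" for k
      unfolding alpha_coeff_def using ne[of k] ub[of _ k]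
      by (intro cSup_least cSup_upper bdd_aboveI[of _ "2 * overhang j"]; blast)+
    have "bdd_above (range ?c)"
      using c by (intro bdd_aboveI[of _ "2 * overhang j"]) auto
    then have "?c 0 \<le> alpha_mixing_rate M X j"
      unfolding alpha_mixing_rate_def by (intro cSUP_upper) auto
    moreover have "alpha_mixing_rate M X j \<le> 2 * overhang j"
      unfolding alpha_mixing_rate_def using c by (intro cSUP_least) auto
    ultimately show ?thesis
      using c(2)[of 0] by linarith
  qed
  have mixing: "strongly_mixing M X"
    unfolding strongly_mixing_def
  proof (rule tendsto_sandwich[of "\<lambda>_. 0" _ _ "\<lambda>j. 2 * overhang j"])
    show "\<forall>\<^sub>F j in sequentially. 0 \<le> alpha_mixing_rate M X j" "\<forall>\<^sub>F j in sequentially. alpha_mixing_rate M X j \<le> 2 * overhang j"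
      using rate by (auto simp: eventually_sequentially intro!: exI[of _ 1])
    show "(\<lambda>j. 2 * overhang j) \<longlonglongrightarrow> 0"
      using tendsto_mult_right_zero[OF overhang_tendsto, of 2] by simp
  qed simp

  \<comment> \<open>Non-degeneracy and positive variance\<close>
  have zero_le: "measure M {x \<in> space M. f x = 0} \<le> 1/2"
  proof -
    have "Measurable.pred coins (\<lambda>\<omega>. Y 0 \<omega> = 0)"
      by measurable
    then have "{\<omega>. Y 0 \<omega> = 0} \<in> sets coins"
      by (simp add: pred_def)
    from measure_\<beta>[OF this] have "measure M (\<beta> -` {\<omega>. Y 0 \<omega> = 0} \<inter> space M) \<le> 1/2"
      using measure_Y_zero_le[of 0] by simp
    also have "\<beta> -` {\<omega>. Y 0 \<omega> = 0} \<inter> space M = {x \<in> space M. f x = 0}"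
      by (auto simp: f_def)
    finally show ?thesis .
  qed
  have f_range: "f x \<in> {-1, 0, 1}" for x
    unfolding f_def by (rule Y_range)
  have nondeg: "nondegenerate_distr (distr M borel f)"
    unfolding nondegenerate_distr_def
  proof
    assume "\<exists>c. measure (distr M borel f) {c} = 1"
    then obtain c where "measure M (f -` {c} \<inter> space M) = 1"
      by (auto simp: measure_distr)
    then have "measure M {x \<in> space M. f x = c} = 1"
      by (simp add: vimage_def Int_def conj_commute)
    then have AE: "AE x in M. f x = c"
      by (subst (asm) M.prob_Collect_eq_1) auto
    \<comment> \<open>The case \<open>k = 0\<close> with the whole space as event gives mean zero.
      An almost sure constant would thus be 0, which has probability at most 1/2.\<close>
    have "(\<integral>x\<in>space M. X 0 x \<partial>M) = 0"
      by (rule set_int) (simp add: generated_sigma_def sigma_sets_top)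
    then have "(\<integral>x. f x \<partial>M) = 0"
      by (simp add: set_integral_space X_int) (simp add: X_def)
    moreover have "(\<integral>x. f x \<partial>M) = (\<integral>x. c \<partial>M)"
      using AE by (intro integral_cong_AE) auto
    ultimately have "c = 0"
      by (simp add: M.prob_space)
    with \<open>measure M {x \<in> space M. f x = c} = 1\<close> zero_le show False
      by simp
  qed
  \<comment> \<open>The square of \<open>f\<close> is the indicator of \<open>f \<noteq> 0\<close>,
    so its integral is at least 1/2.\<close>
  have variance: "(\<integral>x. (f x)\<^sup>2 \<partial>M) > 0"
  proof -
    have "(\<integral>x. (f x)\<^sup>2 \<partial>M) = (\<integral>x. indicator {x \<in> space M. f x \<noteq> 0} x \<partial>M)"
    proof (intro Bochner_Integration.integral_cong refl)
      show "(f x)\<^sup>2 = indicator {x \<in> space M. f x \<noteq> 0} x" if "x \<in> space M" for x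
        using f_range[of x] that by auto
    qed
    also have "\<dots> = measure M {x \<in> space M. f x \<noteq> 0}"
      by simp
    also have "\<dots> = 1 - measure M {x \<in> space M. f x = 0}"
      by (rule M.prob_neg) measurable
    finally show ?thesis
      using zero_le by simp
  qed

  \<comment> \<open>The atom at zero and the distance to the normal law\<close>
  have S_meas [measurable]: "birkhoff_sum T f k \<in> borel_measurable M" for k
  proof -
    have "birkhoff_sum T f k = (\<lambda>x. \<Sum>j<k. X j x)"
      by (simp add: fun_eq_iff birkhoff_sum_def X_def)
    then show ?thesis by simp
  qed
  have zero_ge: "measure M {x \<in> space M. birkhoff_sum T f (n k) x = 0} \<ge> a (n k)" for k
  proof -
    let ?E = "{\<omega>. \<forall>j<n k. Y (int j) \<omega> = 0}"
    \<comment> \<open>The expected number of arrivals of kind \<open>k\<close> in a window of length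
      \<open>n k\<close>. As \<open>r \<le> 1/2\<close>, the bound \<open>r - r\<^sup>2\<close> for
      a zero run is at least \<open>r / 2\<close>, which dominates \<open>a (n k)\<close>.\<close>
    define r :: real where "r = (1/2) ^ (k + 3)"
    have "r \<le> 1/2"
      unfolding r_def using power_decreasing[of 1 "k + 3" "1/2 :: real"] by simp
    then have "r * r \<le> r * (1/2)"
      by (intro mult_left_mono) (auto simp: r_def)
    have "a (n k) \<le> r * (1/2)"
      using m(2)[of k] by (simp add: r_def n_def eval_nat_numeral)
    also have "\<dots> \<le> r - r\<^sup>2"
      using \<open>r * r \<le> r * (1/2)\<close> by (simp add: power2_eq_square)
    also have "\<dots> \<le> measure coins ?E"
      using measure_zero_run[of k "n k"] np[of k] by (simp add: N_def r_def)
    also have "\<dots> = measure M (\<beta> -` ?E \<inter> space M)"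
    proof -
      have "Measurable.pred coins (\<lambda>\<omega>. \<forall>j<n k. Y (int j) \<omega> = 0)"
        by measurable
      then show ?thesis
        by (intro measure_\<beta>[symmetric]) (simp add: pred_def)
    qed
    also have "\<dots> \<le> measure M {x \<in> space M. birkhoff_sum T f (n k) x = 0}"
    proof (rule M.finite_measure_mono)
      show "\<beta> -` ?E \<inter> space M \<subseteq> {x \<in> space M. birkhoff_sum T f (n k) x = 0}"
        using X by (auto simp: birkhoff_sum_def X_def intro!: sum.neutral)
      show "{x \<in> space M. birkhoff_sum T f (n k) x = 0} \<in> sets M"
        by measurable
    qed
    finally show ?thesis .
  qed
  have cdf_ge: "(SUP x. \<bar>normalized_cdf M T f (n k) x - cdf std_normal_distribution x\<bar>) \<ge> a (n k) / 2" for k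
  proof (rule SUP_dist_continuous_cdf_ge_jump)
    interpret \<Phi>: real_distribution std_normal_distribution
      by (rule real_dist_normal_dist)
    show "0 \<le> cdf std_normal_distribution x" "cdf std_normal_distribution x \<le> 1" for x
      by (auto simp: \<Phi>.cdf_nonneg \<Phi>.cdf_bounded_prob)
    show "isCont (cdf std_normal_distribution) 0"
      by (rule isCont_std_normal_cdf)
    show "0 \<le> normalized_cdf M T f (n k) x" "normalized_cdf M T f (n k) x \<le> 1" for x
      by (auto simp: normalized_cdf_def)
    show "normalized_cdf M T f (n k) x + a (n k) \<le> normalized_cdf M T f (n k) 0" if "x < 0" for x
    proof -
      let ?S = "birkhoff_sum T f (n k)"
      \<comment> \<open>Positive variance makes this threshold negative for \<open>x < 0\<close>, so
        the event that the sum is at most \<open>c\<close> is disjoint from the atom at 0; both lie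
        in the event that the sum is at most 0.\<close>
      define c where "c = x * sqrt (\<integral>x. (f x)\<^sup>2 \<partial>M) * sqrt (real (n k))"
      have "c < 0"
        using variance \<open>x < 0\<close> by (auto simp: c_def n_def mult_less_0_iff)
      have "measure M {x \<in> space M. ?S x \<le> c} + measure M {x \<in> space M. ?S x = 0} =
          measure M ({x \<in> space M. ?S x \<le> c} \<union> {x \<in> space M. ?S x = 0})"
        using \<open>c < 0\<close> by (intro M.finite_measure_Union[symmetric]) auto
      also have "\<dots> \<le> measure M {x \<in> space M. ?S x \<le> 0}"
        using \<open>c < 0\<close> by (intro M.finite_measure_mono) auto
      finally show ?thesis
        using zero_ge[of k] by (simp add: normalized_cdf_def c_def)
    qed
  qed

  show ?thesis
  proof (intro exI[of _ T] exI[of _ f] exI[of _ n] conjI allI ballI)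
    show "f \<in> L_infinity M"
    proof -
      have "\<bar>f x\<bar> \<le> 1" for x
        using f_range[of x] by auto
      then show ?thesis
        unfolding L_infinity_def by (auto intro!: exI[of _ 1])
    qed
    show "f x \<in> \<int>" for x
      using f_range[of x] by auto
    show "strict_mono n"
      using m(1) by (auto simp: strict_mono_def n_def)
    show "(f \<circ> (T ^^ k)) x \<in> {-1, 0, 1}" for k x
      using f_range by simp
  qed (use T nondeg mds mixing zero_ge cdf_ge in \<open>auto simp: X_def[abs_def] n_def\<close>)
qed

end
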